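(* Let $R>0$, and for $t\ge 0$ put $\xi(t)=\left(\tfrac32\right)^{1/3}t^{1/3}$ and $h(t)=\xi(t)^2=\left(\tfrac32\right)^{2/3}t^{2/3}$. Define $u:\mathbb{R}^2\times[0,\infty)\to\mathbb{R}$ by $$u(x,t)=\begin{cases}2h(t)-2R^2, & |x_1|\le\xi(t),\ |x_2|\le\xi(t),\\ h(t)+x_2^2-2R^2, & |x_1|\le\xi(t),\ |x_2|>\xi(t),\\ h(t)+x_1^2-2R^2, & |x_2|\le\xi(t),\ |x_1|>\xi(t),\\ x_1^2+x_2^2-2R^2, & |x_1|>\xi(t),\ |x_2|>\xi(t).\end{cases}$$ Then $u$ is a weak solution (in the sense given in the context) in $\mathbb{R}^2$ of $$\frac{\partial u}{\partial t}=\mathrm{div}\left(\frac{u_{x_1}}{|u_{x_1}|},\frac{u_{x_2}}{|u_{x_2}|}\right)$$ with initial datum $u_0(x_1,x_2)=x_1^2+x_2^2-2R^2$. Moreover, the equation, understood as the differential inclusion in the context, is satisfied in $\mathbb{R}^2\times(0,\infty)$ in a pointwise manner, with the exception (for each $t>0$) of a one-dimensional set, and the solution $u$ is Lipschitz continuous, but not $C^1$.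
   Context: Here $\operatorname{sgn}$ is the multivalued sign: $\operatorname{sgn}(s)=\{1\}$ for $s>0$, $\{-1\}$ for $s<0$, and $\operatorname{sgn}(0)=[-1,1]$. A function $u$ is a weak solution with initial datum $u_0$ if $u(\cdot,0)=u_0$ and there is a measurable $\sigma=(\sigma^1,\sigma^2)$ with $\sigma^i\in\operatorname{sgn}u_{x_i}$, $i=1,2$, such that for every $T>0$ and every $\phi\in C_c^\infty(\mathbb{R}^2\times[0,T))$ $$\int_0^T\!\!\int_{\mathbb{R}^2}(u_t\phi+\sigma\cdot\nabla\phi)\,dx\,dt=0.$$ The equation is satisfied pointwise at $(x,t)$ as a differential inclusion if, for the field $\sigma$ above, $\sigma^i(x,t)\in\operatorname{sgn}u_{x_i}(x,t)$ for $i=1,2$ and $u_t(x,t)=\mathrm{div}\,\sigma(x,t)$, all derivatives involved existing at $(x,t)$.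
   Formalization: "Lipschitz continuous" fails globally (u is quadratic in x, and u(0,t) behaves like t^{2/3} at t=0); proved instead: Lipschitz on compact subsets of R²×(0,∞), locally Lipschitz in x locally uniformly in t≥0, and continuous on R²×[0,∞). *)

theory Defs
  imports "HOL-Analysis.Analysis"
begin

section \<open>Smooth and test functions\<close>

primrec Ck_on :: "nat \<Rightarrow> 'a::real_normed_vector set \<Rightarrow> ('a \<Rightarrow> real) \<Rightarrow> bool" where
  "Ck_on 0 S f \<longleftrightarrow> continuous_on S f"
| "Ck_on (Suc k) S f \<longleftrightarrow>
     (\<forall>z\<in>S. f differentiable (at z)) \<and> (\<forall>v. Ck_on k S (\<lambda>z. frechet_derivative f (at z) v))"

text \<open>\<open>S\<close> is meant to be open in \<open>Ck_on k S f\<close>. The functions in \<open>C\<^sub>c\<^sup>\<infinity>(\<Omega>)\<close>, for open \<open>\<Omega>\<close>, are taken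
  extended by zero to the whole space.\<close>

definition test_functions :: "'a::real_normed_vector set \<Rightarrow> ('a \<Rightarrow> real) set" where
  "test_functions \<Omega> = {\<phi>. (\<forall>k. Ck_on k UNIV \<phi>) \<and>
     compact (closure {z. \<phi> z \<noteq> 0}) \<and> closure {z. \<phi> z \<noteq> 0} \<subseteq> \<Omega>}"

section \<open>Derivatives\<close>

definition has_partial :: "('a::real_normed_vector \<Rightarrow> real) \<Rightarrow> 'a \<Rightarrow> real \<Rightarrow> 'a \<Rightarrow> bool" where
  "has_partial f v d z \<longleftrightarrow> ((\<lambda>s. f (z + s *\<^sub>R v)) has_real_derivative d) (at 0)"

definition locally_integrable_on :: "('a::euclidean_space \<Rightarrow> real) \<Rightarrow> 'a set \<Rightarrow> bool" where
  "locally_integrable_on f \<Omega> \<longleftrightarrow> (\<forall>K. compact K \<and> K \<subseteq> \<Omega> \<longrightarrow> set_integrable lebesgue K f)"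

definition has_weak_partial_on ::
    "'a::euclidean_space set \<Rightarrow> ('a \<Rightarrow> real) \<Rightarrow> 'a \<Rightarrow> ('a \<Rightarrow> real) \<Rightarrow> bool" where
  "has_weak_partial_on \<Omega> f v g \<longleftrightarrow>
     locally_integrable_on f \<Omega> \<and> locally_integrable_on g \<Omega> \<and>
     (\<forall>\<psi>\<in>test_functions \<Omega>.
        (LINT z:\<Omega>|lebesgue. f z * frechet_derivative \<psi> (at z) v) = - (LINT z:\<Omega>|lebesgue. g z * \<psi> z))"

section \<open>The equation\<close>

text \<open>Space-time points are pairs \<open>(x, t)\<close>.\<close>

type_synonym spacetime = "(real^2) \<times> real"

definition e_space :: "2 \<Rightarrow> spacetime" where
  "e_space i = (axis i 1, 0)"

definition e_time :: spacetime where
  "e_time = (0, 1)"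

definition multi_sgn :: "real \<Rightarrow> real set" where
  "multi_sgn s = (if s > 0 then {1} else if s < 0 then {-1} else {-1..1})"

text \<open>The derivatives of \<open>u\<close> occurring here are weak derivatives in \<open>\<real>\<^sup>2 \<times> (0,\<infinity>)\<close>. A function in
  \<open>C\<^sub>c\<^sup>\<infinity>(\<real>\<^sup>2 \<times> [0,T))\<close>, which need not vanish at \<open>t = 0\<close>, is the restriction to \<open>t \<ge> 0\<close> of a test
  function on \<open>\<real>\<^sup>2 \<times> (-\<infinity>,T)\<close>. Integrability is required explicitly because the Bochner
  integral of a non-integrable function is \<open>0\<close> by convention.\<close>

definition weak_solution_with ::
    "(spacetime \<Rightarrow> real^2) \<Rightarrow> (spacetime \<Rightarrow> real) \<Rightarrow> (real^2 \<Rightarrow> real) \<Rightarrow> bool" where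
  "weak_solution_with \<sigma> u u0 \<longleftrightarrow>
     (\<forall>x. u (x, 0) = u0 x) \<and>
     \<sigma> \<in> borel_measurable (lebesgue_on (UNIV \<times> {0<..})) \<and>
     (\<exists>ut p.
        has_weak_partial_on (UNIV \<times> {0<..}) u e_time ut \<and>
        (\<forall>i. has_weak_partial_on (UNIV \<times> {0<..}) u (e_space i) (p i)) \<and>
        (AE z in lebesgue_on (UNIV \<times> {0<..}). \<forall>i. \<sigma> z $ i \<in> multi_sgn (p i z)) \<and>
        (\<forall>T>0. \<forall>\<phi>\<in>test_functions (UNIV \<times> {..<T}).
           set_integrable lebesgue (UNIV \<times> {0<..<T})
             (\<lambda>z. ut z * \<phi> z + (\<Sum>i\<in>UNIV. \<sigma> z $ i * frechet_derivative \<phi> (at z) (e_space i))) \<and>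
           (LINT z:UNIV \<times> {0<..<T}|lebesgue.
              ut z * \<phi> z + (\<Sum>i\<in>UNIV. \<sigma> z $ i * frechet_derivative \<phi> (at z) (e_space i))) = 0))"

text \<open>Here all derivatives are classical ones.\<close>

definition satisfied_pointwise ::
    "(spacetime \<Rightarrow> real^2) \<Rightarrow> (spacetime \<Rightarrow> real) \<Rightarrow> spacetime \<Rightarrow> bool" where
  "satisfied_pointwise \<sigma> u z \<longleftrightarrow>
     (\<forall>i. \<exists>p. has_partial u (e_space i) p z \<and> \<sigma> z $ i \<in> multi_sgn p) \<and>
     (\<exists>ut d. has_partial u e_time ut z \<and>
        (\<forall>i. has_partial (\<lambda>w. \<sigma> w $ i) (e_space i) (d i) z) \<and> ut = (\<Sum>i\<in>UNIV. d i))"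

section \<open>Hausdorff dimension\<close>

definition hausdorff_premeasure :: "real \<Rightarrow> real \<Rightarrow> 'a::metric_space set \<Rightarrow> ennreal" where
  "hausdorff_premeasure s \<delta> E =
     (INF C\<in>{C :: nat \<Rightarrow> 'a set. E \<subseteq> (\<Union>n. C n) \<and> (\<forall>n. bounded (C n) \<and> diameter (C n) \<le> \<delta>)}.
        \<Sum>n. ennreal (diameter (C n) powr s))"

definition hausdorff_measure :: "real \<Rightarrow> 'a::metric_space set \<Rightarrow> ennreal" where
  "hausdorff_measure s E = (SUP \<delta>\<in>{0<..}. hausdorff_premeasure s \<delta> E)"

text \<open>Only exponents \<open>s > 0\<close> are used, since \<open>0 powr 0 = 0\<close> would give a wrong \<open>0\<close>-dimensional
  measure; the infimum is unaffected.\<close>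

definition hausdorff_dim :: "'a::metric_space set \<Rightarrow> ereal" where
  "hausdorff_dim E = (INF s\<in>{s. 0 < s \<and> hausdorff_measure s E = 0}. ereal s)"

section \<open>The explicit solution\<close>

definition xi :: "real \<Rightarrow> real" where
  "xi t = (3/2) powr (1/3) * t powr (1/3)"

definition hh :: "real \<Rightarrow> real" where
  "hh t = (xi t)\<^sup>2"

fun u_sol :: "real \<Rightarrow> spacetime \<Rightarrow> real" where
  "u_sol R (x, t) =
     (if \<bar>x $ 1\<bar> \<le> xi t \<and> \<bar>x $ 2\<bar> \<le> xi t then 2 * hh t - 2 * R\<^sup>2
      else if \<bar>x $ 1\<bar> \<le> xi t \<and> \<bar>x $ 2\<bar> > xi t then hh t + (x $ 2)\<^sup>2 - 2 * R\<^sup>2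
      else if \<bar>x $ 2\<bar> \<le> xi t \<and> \<bar>x $ 1\<bar> > xi t then hh t + (x $ 1)\<^sup>2 - 2 * R\<^sup>2
      else (x $ 1)\<^sup>2 + (x $ 2)\<^sup>2 - 2 * R\<^sup>2)"

definition u_init :: "real \<Rightarrow> real^2 \<Rightarrow> real" where
  "u_init R x = (x $ 1)\<^sup>2 + (x $ 2)\<^sup>2 - 2 * R\<^sup>2"

end

theory Submission
  imports Defs
begin

text \<open>
  The solution decouples: with \<open>profile y t = max (y\<^sup>2) (hh t)\<close> one has
  \<open>u(x, t) = profile x\<^sub>1 t + profile x\<^sub>2 t - 2R\<^sup>2\<close>. In one variable, the profile is the parabola
  \<open>y\<^sup>2\<close> cut off by a rising flat facet \<open>|y| \<le> \<xi>(t)\<close>. As selection of the sign of the slope take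
  \<open>flux y t\<close>, which is \<open>y / \<xi>(t)\<close> on the facet and \<open>sgn y\<close> outside. Its \<open>y\<close>-derivative is \<open>1 / \<xi>(t)\<close> on
  the facet and \<open>0\<close> outside, and the law \<open>\<xi>\<^sup>3 = 3t/2\<close> says precisely that \<open>h' = 2\<xi>\<xi>' = 1 / \<xi>\<close>, the
  time derivative of the profile. So the profile moves with \<open>speed\<close> equal to the derivative of the flux,
  off the fronts \<open>|y| = \<xi>(t)\<close>, and summing over the two coordinates gives the equation.

  At a front the profile has slopes \<open>0\<close> and \<open>2y\<close> on the two sides, hence no derivative. Therefore the
  equation fails at time \<open>t\<close> exactly on the four lines \<open>|x\<^sub>i| = \<xi>(t)\<close>, and \<open>u\<close> is not \<open>C\<^sup>1\<close>. That these lines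
  have Hausdorff dimension \<open>1\<close> is elementary: a half-line is covered by consecutive intervals of
  lengths \<open>c, c/2, c/3, \<dots>\<close>, whose \<open>s\<close>-th powers sum to at most \<open>c \<zeta>(s)\<close> if \<open>s > 1\<close> and \<open>c \<le> 1\<close>
  (\<open>hausdorff_measure_ray_null\<close>), while for \<open>s \<le> 1\<close> the projection to a coordinate axis bounds the sum
  from below by a length (\<open>hausdorff_measure_nonzero_if_projection\<close>).

  All integral identities come from one fact, \<open>integral_directional_derivative_eq_0\<close>: the integral of a
  directional derivative over the whole space vanishes, because the integral is translation invariant.
  Applied to \<open>u \<psi>\<close> it identifies the weak derivatives of \<open>u\<close>, since every line parallel to a coordinate
  axis meets the fronts in finitely many points (\<open>has_weak_partial_onI\<close>). The weak formulation
  integrates only the space derivatives by parts, so, \<open>u\<^sub>t\<close> being the divergence of the flux, its integrand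
  is the sum over \<open>i\<close> of the \<open>x\<^sub>i\<close>-derivatives of \<open>flux x\<^sub>i t \<cdot> \<phi>\<close>. No boundary term appears at \<open>t = 0\<close>,
  and the singularity \<open>1 / \<xi>(t) \<sim> t\<close> to the power \<open>-1/3\<close> is integrable (\<open>flux_divergence_theorem\<close>).
\<close>

section \<open>Sets of Hausdorff dimension one\<close>

lemma hausdorff_measure_eq_0_iff:
  "hausdorff_measure s E = 0 \<longleftrightarrow> (\<forall>\<delta>>0. hausdorff_premeasure s \<delta> E = 0)"
  unfolding hausdorff_measure_def bot_ennreal[symmetric] SUP_bot_conv by auto

lemma hausdorff_premeasure_cover:
  assumes "E \<subseteq> (\<Union>n. C n)" "\<And>n. bounded (C n)" "\<And>n. diameter (C n) \<le> \<delta>"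
  shows "hausdorff_premeasure s \<delta> E \<le> (\<Sum>n. ennreal (diameter (C n) powr s))"
  unfolding hausdorff_premeasure_def using assms by (intro INF_lower) auto

text \<open>Covers of the two sets are interleaved into one sequence, so the sums over the covers add up.\<close>

lemma hausdorff_measure_Un_null:
  assumes "hausdorff_measure s A = 0" "hausdorff_measure s B = 0"
  shows "hausdorff_measure s (A \<union> B) = 0"
  unfolding hausdorff_measure_eq_0_iff
proof (intro allI impI)
  fix \<delta> :: real assume "\<delta> > 0"
  define P where "P E C \<longleftrightarrow> E \<subseteq> (\<Union>n. C n) \<and> (\<forall>n. bounded (C n) \<and> diameter (C n) \<le> \<delta>)"
    for E and C :: "nat \<Rightarrow> 'a set"
  define S where "S C = (\<Sum>n. ennreal (diameter (C n) powr s))" for C :: "nat \<Rightarrow> 'a set"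
  have merge: "hausdorff_premeasure s \<delta> (A \<union> B) \<le> S X + S Y" if X: "P A X" and Y: "P B Y" for X Y
  proof -
    define Z where "Z n = (if even n then X (n div 2) else Y (n div 2))" for n
    have "(\<Union>n. Z n) = (\<Union>n. X n) \<union> (\<Union>n. Y n)"
    proof
      show "(\<Union>n. Z n) \<subseteq> (\<Union>n. X n) \<union> (\<Union>n. Y n)"
        by (auto simp: Z_def split: if_splits)
      have "X n = Z (2 * n)" "Y n = Z (2 * n + 1)" for n by (auto simp: Z_def)
      then show "(\<Union>n. X n) \<union> (\<Union>n. Y n) \<subseteq> (\<Union>n. Z n)" by blast
    qed
    then have "hausdorff_premeasure s \<delta> (A \<union> B) \<le> S Z"
      using X Y unfolding S_def P_def by (intro hausdorff_premeasure_cover) (auto simp: Z_def)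
    also have "S Z \<le> S X + S Y"
      unfolding S_def[of Z]
    proof (rule suminf_le_const)
      fix N
      define d where "d n = ennreal (diameter (Z n) powr s)" for n
      have "sum d {..<N} \<le> sum d {..<2 * N}"
        by (rule sum_mono2) auto
      also have "sum d {..<2 * N} = (\<Sum>n<N. d (2 * n)) + (\<Sum>n<N. d (2 * n + 1))"
        by (induction N) (auto simp: algebra_simps)
      also have "\<dots> \<le> S X + S Y"
        unfolding S_def d_def Z_def by (intro add_mono) (auto intro!: sum_le_suminf simp del: sum_ennreal)
      finally show "(\<Sum>n<N. ennreal (diameter (Z n) powr s)) \<le> S X + S Y"
        unfolding d_def .
    qed simp
    finally show ?thesis .
  qed
  have small: "\<exists>X. P E X \<and> S X < ennreal e" if "hausdorff_measure s E = 0" "e > 0" for E and e :: real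
  proof -
    have "hausdorff_premeasure s \<delta> E < ennreal e"
      using that \<open>\<delta> > 0\<close> unfolding hausdorff_measure_eq_0_iff by auto
    then show ?thesis
      unfolding hausdorff_premeasure_def INF_less_iff P_def S_def by auto
  qed
  have "hausdorff_premeasure s \<delta> (A \<union> B) \<le> 0"
  proof (rule ennreal_le_epsilon)
    fix e :: real assume "e > 0"
    then obtain X Y where XY: "P A X" "S X < ennreal (e / 2)" "P B Y" "S Y < ennreal (e / 2)"
      using small[OF assms(1), of "e / 2"] small[OF assms(2), of "e / 2"] by auto
    have "hausdorff_premeasure s \<delta> (A \<union> B) \<le> S X + S Y" using XY by (intro merge)
    also have "\<dots> \<le> ennreal (e / 2) + ennreal (e / 2)" using XY by (intro add_mono) auto
    also have "\<dots> = 0 + ennreal e" using \<open>e > 0\<close> by (simp flip: ennreal_plus)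
    finally show "hausdorff_premeasure s \<delta> (A \<union> B) \<le> 0 + ennreal e" .
  qed
  then show "hausdorff_premeasure s \<delta> (A \<union> B) = 0" by simp
qed

text \<open>Consecutive pieces of lengths \<open>c / (n + 1)\<close> exhaust the half-line because the harmonic series
  diverges, while the sum of the \<open>s\<close>-th powers of their lengths converges and is \<open>O(c)\<close>.\<close>

lemma hausdorff_measure_ray_null:
  fixes f :: "real \<Rightarrow> 'a::real_normed_vector"
  assumes f: "1-lipschitz_on UNIV f" and s: "s > 1"
  shows "hausdorff_measure s (f ` {0..}) = 0"
  unfolding hausdorff_measure_eq_0_iff
proof (intro allI impI)
  fix \<delta> :: real assume "\<delta> > 0"
  define Z where "Z = (\<Sum>n. real (Suc n) powr - s)"
  have sumZ: "summable (\<lambda>n. real (Suc n) powr - s)"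
    using s summable_real_powr_iff[of "-s"] by (subst summable_Suc_iff) simp
  have Z: "Z \<ge> 0" unfolding Z_def by (intro suminf_nonneg sumZ) auto
  have bound: "hausdorff_premeasure s \<delta> (f ` {0..}) \<le> ennreal (c * Z)" if c: "0 < c" "c \<le> 1" "c \<le> \<delta>" for c
  proof -
    define a where "a n = c * harm n" for n :: nat
    define C where "C n = f ` {a n..a (Suc n)}" for n
    have step: "a (Suc n) = a n + c / real (Suc n)" for n
      by (simp add: a_def harm_Suc field_simps)
    have lim: "filterlim a at_top sequentially"
      unfolding a_def using c(1) harm_at_top by (intro filterlim_tendsto_pos_mult_at_top[OF tendsto_const])
    have "f ` {0..} \<subseteq> (\<Union>n. C n)"
    proof
      fix y assume "y \<in> f ` {0..}"
      then obtain x where x: "x \<ge> 0" "y = f x" by auto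
      define n where "n = (LEAST n. x \<le> a n)"
      obtain N where "x \<le> a N"
        using lim unfolding filterlim_at_top eventually_sequentially by blast
      then have n: "x \<le> a n" unfolding n_def by (rule LeastI)
      show "y \<in> (\<Union>n. C n)"
      proof (cases n)
        case 0
        then have "x = a 0" using x n by (simp add: a_def harm_def)
        moreover have "a 0 \<le> a (Suc 0)" using step[of 0] c by simp
        ultimately have "x \<in> {a 0..a (Suc 0)}" by simp
        then show ?thesis using x unfolding C_def by blast
      next
        case (Suc m)
        then have "\<not> x \<le> a m" using not_less_Least[of m "\<lambda>n. x \<le> a n"] by (simp add: n_def)
        then have "x \<in> {a m..a (Suc m)}" using n Suc by auto
        then show ?thesis using x unfolding C_def by blast
      qed
    qed
    moreover have bdd: "bounded (C n)" for n
    proof -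
      have "continuous_on {a n..a (Suc n)} f"
        using lipschitz_on_continuous_on[OF f] continuous_on_subset by blast
      then show ?thesis unfolding C_def
        by (intro compact_imp_bounded compact_continuous_image) auto
    qed
    moreover have diam: "diameter (C n) \<le> c / real (Suc n)" for n
    proof (rule diameter_le)
      fix x y assume "x \<in> C n" "y \<in> C n"
      then obtain p q where pq: "p \<in> {a n..a (Suc n)}" "q \<in> {a n..a (Suc n)}" "x = f p" "y = f q"
        unfolding C_def by blast
      have "norm (x - y) \<le> dist p q"
        using lipschitz_onD[OF f, of p q] pq by (simp add: dist_norm)
      also have "\<dots> \<le> c / real (Suc n)"
        using pq step[of n] by (auto simp: dist_real_def)
      finally show "norm (x - y) \<le> c / real (Suc n)" .
    qed (use c in simp)
    moreover have "c / real (Suc n) \<le> \<delta>" for n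
      proof -
      have "c / real (Suc n) \<le> c / 1" using c by (intro divide_left_mono) auto
      with c show ?thesis by simp
    qed
    ultimately have "hausdorff_premeasure s \<delta> (f ` {0..}) \<le> (\<Sum>n. ennreal (diameter (C n) powr s))"
      using order_trans by (intro hausdorff_premeasure_cover) blast+
    also have "\<dots> \<le> (\<Sum>n. ennreal (c * real (Suc n) powr - s))"
    proof (intro suminf_le ennreal_leI)
      fix n
      have "diameter (C n) powr s \<le> (c / real (Suc n)) powr s"
        using diam[of n] s bdd
        by (intro powr_mono2 diameter_ge_0) auto
      also have "\<dots> = c powr s * real (Suc n) powr - s"
        using c by (simp add: powr_divide powr_minus field_simps)
      also have "c powr s \<le> c powr 1" using c s by (intro powr_mono') auto
      finally show "diameter (C n) powr s \<le> c * real (Suc n) powr - s"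
        using c by (simp add: mult_right_mono)
    qed auto
    also have "\<dots> = ennreal (\<Sum>n. c * real (Suc n) powr - s)"
      using c by (intro suminf_ennreal2 summable_mult sumZ) auto
    also have "(\<Sum>n. c * real (Suc n) powr - s) = c * Z"
      unfolding Z_def by (rule suminf_mult[OF sumZ])
    finally show ?thesis .
  qed
  have "hausdorff_premeasure s \<delta> (f ` {0..}) \<le> 0"
  proof (rule ennreal_le_epsilon)
    fix e :: real assume e: "0 < e"
    \<comment> \<open>\<open>Z + 1\<close> instead of \<open>Z\<close> keeps the denominator visibly positive.\<close>
    define c where "c = min (min 1 \<delta>) (e / (Z + 1))"
    have c: "0 < c" "c \<le> 1" "c \<le> \<delta>" "c \<le> e / (Z + 1)"
      using Z e \<open>\<delta> > 0\<close> by (auto simp: c_def)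
    have "c * Z \<le> c * (Z + 1)" using c by simp
    also have "\<dots> \<le> e" using c(4) Z by (simp add: field_simps)
    finally have "c * Z \<le> e" .
    then show "hausdorff_premeasure s \<delta> (f ` {0..}) \<le> 0 + ennreal e"
      using bound[OF c(1-3)] by (simp add: order_trans[OF _ ennreal_leI])
  qed
  then show "hausdorff_premeasure s \<delta> (f ` {0..}) = 0" by simp
qed

text \<open>For sets of diameter at most \<open>1\<close> and \<open>s \<le> 1\<close>, the diameter is at most its \<open>s\<close>-th power. The projections of
  the covering sets lie in intervals of radius equal to their diameter, and these intervals
  cover the unit interval.\<close>

lemma hausdorff_measure_nonzero_if_projection:
  fixes p :: "'a::metric_space \<Rightarrow> real"
  assumes p: "1-lipschitz_on UNIV p" and E: "{0..1} \<subseteq> p ` E" and s: "0 < s" "s \<le> 1"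
  shows "hausdorff_measure s E \<noteq> 0"
proof -
  have "ennreal (1/2) \<le> hausdorff_premeasure s 1 E"
    unfolding hausdorff_premeasure_def
  proof (rule INF_greatest)
    fix C :: "nat \<Rightarrow> 'a set"
    assume "C \<in> {C. E \<subseteq> \<Union> (range C) \<and> (\<forall>n. bounded (C n) \<and> diameter (C n) \<le> 1)}"
    then have C: "E \<subseteq> (\<Union>n. C n)" "\<And>n. bounded (C n)" "\<And>n. diameter (C n) \<le> 1" by auto
    define J where "J n = (if C n = {} then {} else cball (p (SOME x. x \<in> C n)) (diameter (C n)))" for n
    have in_J: "p x \<in> J n" if "x \<in> C n" for x n
    proof -
      have "(SOME x. x \<in> C n) \<in> C n" using that by (rule someI)
      then have "dist (SOME x. x \<in> C n) x \<le> diameter (C n)"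
        using that C(2) by (intro diameter_bounded_bound)
      then show ?thesis
        using lipschitz_onD[OF p, of "SOME x. x \<in> C n" x] that by (auto simp: J_def)
    qed
    have cov: "{0..1} \<subseteq> (\<Union>n. J n)"
    proof
      fix y :: real assume "y \<in> {0..1}"
      then obtain x where "x \<in> E" "y = p x" using E by blast
      moreover from this obtain n where "x \<in> C n" using C(1) by blast
      ultimately show "y \<in> (\<Union>n. J n)" using in_J[of x n] by blast
    qed
    have J[measurable]: "J n \<in> sets lborel" for n by (simp add: J_def)
    have "ennreal 1 = emeasure lborel {0..1::real}" by simp
    also have "\<dots> \<le> emeasure lborel (\<Union>n. J n)" by (intro emeasure_mono cov sets.countable_UN) (use J in auto)
    also have "\<dots> \<le> (\<Sum>n. emeasure lborel (J n))" by (intro emeasure_subadditive_countably) (use J in auto)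
    also have "\<dots> \<le> (\<Sum>n. 2 * ennreal (diameter (C n) powr s))"
    proof (rule suminf_le)
      fix n
      have d: "0 \<le> diameter (C n)" using C(2) by (rule diameter_ge_0)
      have "emeasure lborel (J n) \<le> ennreal (2 * diameter (C n))"
        using d by (auto simp: J_def cball_eq_atLeastAtMost)
      also have "diameter (C n) \<le> diameter (C n) powr s"
        using powr_mono'[of s 1 "diameter (C n)"] d C(3)[of n] s by simp
      finally show "emeasure lborel (J n) \<le> 2 * ennreal (diameter (C n) powr s)"
        by (simp add: ennreal_mult ennreal_leI)
    qed auto
    also have "\<dots> = 2 * (\<Sum>n. ennreal (diameter (C n) powr s))" by simp
    finally have "ennreal (1/2) * 1 \<le> ennreal (1/2) * (2 * (\<Sum>n. ennreal (diameter (C n) powr s)))"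
      by (intro mult_left_mono) auto
    also have "\<dots> = ennreal (1/2 * 2) * (\<Sum>n. ennreal (diameter (C n) powr s))"
      using ennreal_mult[of "1/2" 2] by (simp flip: mult.assoc)
    finally show "ennreal (1/2) \<le> (\<Sum>n. ennreal (diameter (C n) powr s))" by simp
  qed
  then have "hausdorff_premeasure s 1 E \<noteq> 0" by auto
  then show ?thesis unfolding hausdorff_measure_eq_0_iff using zero_less_one by blast
qed

lemma hausdorff_dim_eq_1I:
  assumes "\<And>s. s > 1 \<Longrightarrow> hausdorff_measure s E = 0"
    and "\<And>s. 0 < s \<Longrightarrow> s < 1 \<Longrightarrow> hausdorff_measure s E \<noteq> 0"
  shows "hausdorff_dim E = 1"
  unfolding hausdorff_dim_def
proof (rule antisym)
  show "(INF s\<in>{s. 0 < s \<and> hausdorff_measure s E = 0}. ereal s) \<le> 1"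
  proof (rule ereal_le_epsilon2)
    fix e :: real assume "0 < e"
    then have "(INF s\<in>{s. 0 < s \<and> hausdorff_measure s E = 0}. ereal s) \<le> ereal (1 + e)"
      using assms(1)[of "1 + e"] by (intro INF_lower) auto
    then show "(INF s\<in>{s. 0 < s \<and> hausdorff_measure s E = 0}. ereal s) \<le> 1 + ereal e"
      by (simp add: one_ereal_def)
  qed
  show "1 \<le> (INF s\<in>{s. 0 < s \<and> hausdorff_measure s E = 0}. ereal s)"
  proof (rule INF_greatest)
    fix s assume "s \<in> {s. 0 < s \<and> hausdorff_measure s E = 0}"
    then have "\<not> s < 1" using assms(2)[of s] by blast
    then show "1 \<le> ereal s" by (simp add: one_ereal_def)
  qed
qed

section \<open>Weak derivatives of functions with finitely many kinks on each line\<close>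

lemma integrable_lborel_translate:
  fixes f :: "'a::euclidean_space \<Rightarrow> real"
  assumes "integrable lborel f"
  shows "integrable lborel (\<lambda>z. f (z + c))"
  using assms integrable_distr_eq[of "(+) c" lborel borel f]
  by (simp add: lborel_distr_plus add.commute)

lemma integral_lborel_translate:
  fixes f :: "'a::euclidean_space \<Rightarrow> real"
  assumes [measurable]: "f \<in> borel_measurable borel"
  shows "(LINT z|lborel. f (z + c)) = integral\<^sup>L lborel f"
  using integral_distr[of "(+) c" lborel borel f]
  by (simp add: lborel_distr_plus add.commute)

text \<open>Integrate the hypothesis \<open>line\<close> over all \<open>z\<close>. The right-hand side gives \<open>0\<close> by translation
  invariance; on the left-hand side, after exchanging the integrals, each \<open>r\<close> contributes the same
  number, the integral of \<open>f\<close>. Working with translations avoids slicing the space along \<open>v\<close>.\<close>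

lemma integral_directional_derivative_eq_0:
  fixes F f :: "'a::euclidean_space \<Rightarrow> real"
  assumes F: "integrable lborel F" and f: "integrable lborel f"
    and line: "\<And>z. (LINT r:{0..1}|lborel. f (z + r *\<^sub>R v)) = F (z + v) - F z"
  shows "integral\<^sup>L lborel f = 0"
proof -
  have [measurable]: "f \<in> borel_measurable borel" "F \<in> borel_measurable borel"
    using F f by auto
  let ?g = "\<lambda>r z. indicat_real {0..1} r *\<^sub>R f (z + r *\<^sub>R v)"
  have abs_int: "(LINT z|lborel. norm (?g r z)) = indicat_real {0..1} r * (LINT z|lborel. \<bar>f z\<bar>)" for r :: real
    using integral_lborel_translate[of "\<lambda>z. \<bar>f z\<bar>" "r *\<^sub>R v"] by (simp add: abs_mult)
  have int: "integrable (lborel \<Otimes>\<^sub>M lborel) (case_prod ?g)"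
  proof (rule lborel_pair.Fubini_integrable)
    show "integrable lborel (\<lambda>r. LINT z|lborel. norm (case (r, z) of (r, z) \<Rightarrow> ?g r z))"
      unfolding prod.case abs_int by simp
    show "AE r in lborel. integrable lborel (\<lambda>z. case (r, z) of (r, z) \<Rightarrow> ?g r z)"
      using integrable_lborel_translate[OF f] by auto
  qed measurable
  have "(LINT z|lborel. LINT r|lborel. ?g r z) = (LINT r|lborel. LINT z|lborel. ?g r z)"
    using int by (rule lborel_pair.Fubini_integral)
  also have "\<dots> = (LINT r|lborel. indicat_real {0..1::real} r * integral\<^sup>L lborel f)"
    by (simp add: integral_lborel_translate)
  also have "\<dots> = integral\<^sup>L lborel f" by simp
  finally have "integral\<^sup>L lborel f = (LINT z|lborel. F (z + v) - F z)"
    using line by (simp add: set_lebesgue_integral_def)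
  also have "\<dots> = (LINT z|lborel. F (z + v)) - (LINT z|lborel. F z)"
    using F by (intro Bochner_Integration.integral_diff integrable_lborel_translate)
  finally show ?thesis by (simp add: integral_lborel_translate)
qed

text \<open>The form in which the fundamental theorem of calculus meets the hypothesis \<open>line\<close> above: finitely
  many kinks are harmless, and boundedness turns the gauge integral into a Lebesgue integral.\<close>

lemma line_integral_piecewise_derivative:
  fixes G g :: "real \<Rightarrow> real"
  assumes S: "finite S" and cont: "continuous_on {0..1} G"
    and deriv: "\<And>r. r \<in> {0<..<1} - S \<Longrightarrow> (G has_real_derivative g r) (at r)"
    and meas: "g \<in> borel_measurable borel" and bound: "\<And>r. \<bar>g r\<bar> \<le> B"
  shows "(LINT r:{0..1}|lborel. g r) = G 1 - G 0"
proof -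
  have "(g has_integral G 1 - G 0) {0..1}"
    using S cont deriv
    by (intro fundamental_theorem_of_calculus_interior_strong)
       (auto simp: has_real_derivative_iff_has_vector_derivative)
  moreover have "set_integrable lborel {0..1} g"
    unfolding set_integrable_def using meas bound
    by (intro integrableI_bounded_set_indicator[where B = B]) auto
  ultimately show ?thesis
    by (simp add: set_borel_integral_eq_integral(2) integral_unique)
qed

lemma has_partial_frechet_derivative:
  assumes "f differentiable (at z)"
  shows "has_partial f v (frechet_derivative f (at z) v) z"
proof -
  have D: "(f has_derivative frechet_derivative f (at z)) (at (z + 0 *\<^sub>R v))"
    using assms by (simp add: frechet_derivative_works)
  have "((\<lambda>s. f (z + s *\<^sub>R v)) has_derivative (\<lambda>s. frechet_derivative f (at z) (s *\<^sub>R v))) (at 0)"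
    by (rule has_derivative_compose[where f = "\<lambda>s. z + s *\<^sub>R v", OF _ D])
       (auto intro!: derivative_eq_intros)
  moreover have "frechet_derivative f (at z) (s *\<^sub>R v) = frechet_derivative f (at z) v * s" for s
    using linear_scale[OF has_derivative_linear[OF D]] by simp
  ultimately show ?thesis
    unfolding has_partial_def has_field_derivative_def by simp
qed

lemma test_function_has_partial:
  assumes "\<phi> \<in> test_functions \<Omega>"
  shows "has_partial \<phi> v (frechet_derivative \<phi> (at z) v) z"
proof -
  have "Ck_on (Suc 0) UNIV \<phi>" using assms unfolding test_functions_def by blast
  then show ?thesis by (intro has_partial_frechet_derivative) simp
qed

lemma test_function_continuous:
  assumes "\<phi> \<in> test_functions \<Omega>"
  shows "continuous_on UNIV \<phi>" "continuous_on UNIV (\<lambda>z. frechet_derivative \<phi> (at z) v)"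
proof -
  have "Ck_on 0 UNIV \<phi>" "Ck_on (Suc 0) UNIV \<phi>"
    using assms unfolding test_functions_def by blast+
  then show "continuous_on UNIV \<phi>" "continuous_on UNIV (\<lambda>z. frechet_derivative \<phi> (at z) v)"
    by simp_all
qed

lemma test_function_support:
  assumes "\<phi> \<in> test_functions \<Omega>"
  obtains K where "compact K" "K \<subseteq> \<Omega>" "\<And>z. z \<notin> K \<Longrightarrow> \<phi> z = 0"
    "\<And>z v. z \<notin> K \<Longrightarrow> frechet_derivative \<phi> (at z) v = 0"
proof
  let ?K = "closure {z. \<phi> z \<noteq> 0}"
  show "compact ?K" "?K \<subseteq> \<Omega>" using assms by (auto simp: test_functions_def)
  show z: "\<phi> z = 0" if "z \<notin> ?K" for z
    using that closure_subset[of "{z. \<phi> z \<noteq> 0}"] by auto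
  show "frechet_derivative \<phi> (at z) v = 0" if "z \<notin> ?K" for z v
  proof -
    have "((\<lambda>_. 0) has_derivative (\<lambda>_. 0)) (at z)" by simp
    then have "(\<phi> has_derivative (\<lambda>_. 0)) (at z)"
    proof (rule has_derivative_transform_within_open[where s = "- ?K"])
      show "0 = \<phi> w" if "w \<in> - ?K" for w using z[of w] that by simp
      show "open (- ?K)" by (intro open_Compl closed_closure)
      show "z \<in> - ?K" using that by simp
    qed
    then have "(\<lambda>_. 0) = frechet_derivative \<phi> (at z)" by (rule frechet_derivative_at)
    then show ?thesis by metis
  qed
qed

lemma integrable_lborel_bounded_support:
  fixes f :: "'a::euclidean_space \<Rightarrow> real"
  assumes "f \<in> borel_measurable borel" "compact K" "\<And>z. z \<in> K \<Longrightarrow> \<bar>f z\<bar> \<le> B"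
    "\<And>z. z \<notin> K \<Longrightarrow> f z = 0"
  shows "integrable lborel f"
  using assms emeasure_compact_finite[of K]
  by (intro integrableI_bounded_set[where A = K and B = B]) (auto simp: less_top intro: borel_closed compact_imp_closed)

lemma set_integral_lebesgue_eq_lborel:
  fixes f :: "'a::euclidean_space \<Rightarrow> real"
  assumes "f \<in> borel_measurable borel" "\<And>z. z \<notin> \<Omega> \<Longrightarrow> f z = 0"
  shows "(LINT z:\<Omega>|lebesgue. f z) = (LINT z|lborel. f z)"
proof -
  have "(LINT z:\<Omega>|lebesgue. f z) = (LINT z|lebesgue. f z)"
    unfolding set_lebesgue_integral_def
    by (rule Bochner_Integration.integral_cong) (use assms(2) in \<open>auto simp: indicator_def\<close>)
  also have "\<dots> = (LINT z|lborel. f z)"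
    by (rule integral_completion) (use assms(1) in simp)
  finally show ?thesis .
qed

lemma locally_integrable_onI:
  fixes f :: "'a::euclidean_space \<Rightarrow> real"
  assumes \<Omega>: "open \<Omega>" and meas: "(\<lambda>z. indicator \<Omega> z * f z) \<in> borel_measurable borel"
    and bdd: "\<And>K. compact K \<Longrightarrow> K \<subseteq> \<Omega> \<Longrightarrow> bounded (f ` K)"
  shows "locally_integrable_on f \<Omega>"
  unfolding locally_integrable_on_def set_integrable_def
proof (intro allI impI)
  fix K assume K: "compact K \<and> K \<subseteq> \<Omega>"
  then obtain B where B: "\<And>z. z \<in> K \<Longrightarrow> \<bar>f z\<bar> \<le> B"
    using bdd[of K] by (auto simp: bounded_iff)
  have eq: "indicator K z *\<^sub>R f z = indicator K z * (indicator \<Omega> z * f z)" for z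
    using K by (auto simp: indicator_def)
  have [measurable]: "K \<in> sets borel" using K by (auto intro: borel_closed compact_imp_closed)
  have m [measurable]: "(\<lambda>z. indicator K z *\<^sub>R f z) \<in> borel_measurable borel"
    unfolding eq using meas by measurable
  have "integrable lborel (\<lambda>z. indicator K z *\<^sub>R f z)"
    using K B by (intro integrable_lborel_bounded_support[OF m, of K B]) auto
  then show "integrable lebesgue (\<lambda>z. indicator K z *\<^sub>R f z)"
    by (subst integrable_completion) auto
qed

lemma has_partial_shift:
  "has_partial f v d (z + r *\<^sub>R v) \<longleftrightarrow> ((\<lambda>s. f (z + s *\<^sub>R v)) has_real_derivative d) (at r)"
  unfolding has_partial_def
  using DERIV_shift[of "\<lambda>s. f (z + s *\<^sub>R v)" d 0 r] by (simp add: scaleR_add_left add_ac)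

lemma has_partial_cong:
  assumes "open S" "z \<in> S" "\<And>w. w \<in> S \<Longrightarrow> f w = g w"
  shows "has_partial f v d z \<longleftrightarrow> has_partial g v d z"
  unfolding has_partial_def
proof (rule DERIV_cong_ev)
  have "open ((\<lambda>s. z + s *\<^sub>R v) -` S)"
    using assms(1) by (intro open_vimage) (auto intro!: continuous_intros)
  then have "eventually (\<lambda>s. z + s *\<^sub>R v \<in> S) (nhds 0)"
    using assms(2) unfolding eventually_nhds
    by (intro exI[of _ "(\<lambda>s. z + s *\<^sub>R v) -` S"]) auto
  then show "eventually (\<lambda>s. f (z + s *\<^sub>R v) = g (z + s *\<^sub>R v)) (nhds 0)"
    by eventually_elim (rule assms(3))
qed auto

lemma has_partial_mult:
  assumes "has_partial f v a z" "has_partial g v b z"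
  shows "has_partial (\<lambda>w. f w * g w) v (a * g z + f z * b) z"
  using DERIV_mult[OF assms[unfolded has_partial_def]] unfolding has_partial_def
  by (simp add: algebra_simps)

text \<open>Along each line parallel to \<open>v\<close>, the function is continuous and has a locally bounded derivative up to
  finitely many kinks, so it can be integrated by parts there: \<open>w \<psi> + u D\<^sub>v\<psi>\<close> is the derivative of
  \<open>u \<psi>\<close> by the product rule, and its integral vanishes.\<close>

lemma has_weak_partial_onI:
  fixes u w :: "'a::euclidean_space \<Rightarrow> real"
  assumes \<Omega>: "open \<Omega>" and cont: "continuous_on \<Omega> u"
    and meas [measurable]: "w \<in> borel_measurable borel"
    and bdd: "\<And>K. compact K \<Longrightarrow> K \<subseteq> \<Omega> \<Longrightarrow> bounded (w ` K)"
    and kinks: "\<And>z. finite {r. z + r *\<^sub>R v \<in> \<Omega> \<and> \<not> has_partial u v (w (z + r *\<^sub>R v)) (z + r *\<^sub>R v)}"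
  shows "has_weak_partial_on \<Omega> u v w"
  unfolding has_weak_partial_on_def
proof (intro conjI ballI)
  have u_meas: "(\<lambda>z. indicator \<Omega> z * u z) \<in> borel_measurable borel"
    using borel_measurable_continuous_on_indicator[OF _ cont] \<Omega> by simp
  show "locally_integrable_on u \<Omega>"
  proof (rule locally_integrable_onI[OF \<Omega> u_meas])
    show "bounded (u ` K)" if "compact K" "K \<subseteq> \<Omega>" for K
      by (intro compact_imp_bounded compact_continuous_image continuous_on_subset[OF cont] that)
  qed
  show "locally_integrable_on w \<Omega>"
    using \<Omega> by (intro locally_integrable_onI bdd) auto
  fix \<psi> assume \<psi>: "\<psi> \<in> test_functions \<Omega>"
  let ?D = "\<lambda>z. frechet_derivative \<psi> (at z) v"
  obtain K where K: "compact K" "K \<subseteq> \<Omega>" "\<And>z. z \<notin> K \<Longrightarrow> \<psi> z = 0" 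
    "\<And>z v. z \<notin> K \<Longrightarrow> frechet_derivative \<psi> (at z) v = 0"
    by (rule test_function_support[OF \<psi>]) blast
  have open_K: "open (- K)" using K(1) by (intro open_Compl compact_imp_closed)
  \<comment> \<open>Outside \<open>\<Omega>\<close> nothing is known of \<open>u\<close>, but there the factor \<open>k\<close> vanishes on an open set.\<close>
  have cont_ext: "continuous_on UNIV (\<lambda>z. u z * k z)"
    if k: "continuous_on UNIV k" "\<And>z. z \<notin> K \<Longrightarrow> k z = 0" for k :: "'a \<Rightarrow> real"
  proof -
    have "continuous_on (\<Omega> \<union> - K) (\<lambda>z. u z * k z)"
    proof (rule continuous_on_open_Un)
      show "continuous_on \<Omega> (\<lambda>z. u z * k z)"
        using cont k(1) continuous_on_subset by (intro continuous_intros) blast+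
      show "continuous_on (- K) (\<lambda>z. u z * k z)"
        by (rule continuous_on_eq[of _ "\<lambda>_. 0"]) (use k(2) in auto)
    qed (fact \<Omega> open_K)+
    moreover have "\<Omega> \<union> - K = UNIV" using K(2) by blast
    ultimately show ?thesis by simp
  qed
  note cont\<psi> = test_function_continuous[OF \<psi>]
  have cF: "continuous_on UNIV (\<lambda>z. u z * \<psi> z)" by (intro cont_ext cont\<psi> K(3))
  have cD: "continuous_on UNIV (\<lambda>z. u z * ?D z)" by (intro cont_ext cont\<psi> K(4))
  note [measurable] = borel_measurable_continuous_onI[OF cF] borel_measurable_continuous_onI[OF cD]
    borel_measurable_continuous_onI[OF cont\<psi>(1)]
  define F where "F z = u z * \<psi> z" for z
  define f where "f z = w z * \<psi> z + u z * ?D z" for z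
  have bounded_on_K: "\<exists>B. \<forall>z\<in>K. \<bar>k z\<bar> \<le> B" if "continuous_on UNIV k" for k :: "'a \<Rightarrow> real"
    using compact_imp_bounded[OF compact_continuous_image[OF continuous_on_subset[OF that] K(1)]]
    by (auto simp: bounded_iff)
  obtain BF where BF: "\<And>z. z \<in> K \<Longrightarrow> \<bar>u z * \<psi> z\<bar> \<le> BF" using bounded_on_K[OF cF] by blast
  obtain BD where BD: "\<And>z. z \<in> K \<Longrightarrow> \<bar>u z * ?D z\<bar> \<le> BD" using bounded_on_K[OF cD] by blast
  obtain B\<psi> where B\<psi>: "\<And>z. z \<in> K \<Longrightarrow> \<bar>\<psi> z\<bar> \<le> B\<psi>" using bounded_on_K[OF cont\<psi>(1)] by blast
  obtain Bw where Bw: "\<And>z. z \<in> K \<Longrightarrow> \<bar>w z\<bar> \<le> Bw" using bdd[OF K(1,2)] by (auto simp: bounded_iff)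
  have Bw\<psi>: "\<bar>w z * \<psi> z\<bar> \<le> Bw * B\<psi>" if "z \<in> K" for z
    unfolding abs_mult using Bw[OF that] B\<psi>[OF that] by (intro mult_mono) auto
  have int1: "integrable lborel (\<lambda>z. w z * \<psi> z)"
    by (rule integrable_lborel_bounded_support[OF _ K(1) Bw\<psi>]) (auto simp: K(3))
  have int2: "integrable lborel (\<lambda>z. u z * ?D z)"
    by (rule integrable_lborel_bounded_support[OF _ K(1) BD]) (auto simp: K(4))
  have fB: "\<bar>f z\<bar> \<le> \<bar>Bw * B\<psi>\<bar> + \<bar>BD\<bar>" for z
  proof (cases "z \<in> K")
    case True
    then show ?thesis using Bw\<psi>[OF True] BD[OF True] unfolding f_def by linarith
  qed (simp add: f_def K(3,4))
  have [measurable]: "f \<in> borel_measurable borel" unfolding f_def by measurable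
  have "integral\<^sup>L lborel f = 0"
  proof (rule integral_directional_derivative_eq_0)
    show "integrable lborel F"
      unfolding F_def by (rule integrable_lborel_bounded_support[OF _ K(1) BF]) (auto simp: K(3))
    show "integrable lborel f" unfolding f_def using int1 int2 by simp
    fix z
    let ?S = "{r. z + r *\<^sub>R v \<in> \<Omega> \<and> \<not> has_partial u v (w (z + r *\<^sub>R v)) (z + r *\<^sub>R v)}"
    have "(LINT r:{0..1}|lborel. f (z + r *\<^sub>R v)) = F (z + 1 *\<^sub>R v) - F (z + 0 *\<^sub>R v)"
    proof (rule line_integral_piecewise_derivative[OF kinks[of z]])
      show "continuous_on {0..1} (\<lambda>r. F (z + r *\<^sub>R v))"
        unfolding F_def by (rule continuous_on_compose2[OF cF]) (auto intro!: continuous_intros)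
      show "(\<lambda>r. f (z + r *\<^sub>R v)) \<in> borel_measurable borel" by measurable
      show "\<bar>f (z + r *\<^sub>R v)\<bar> \<le> \<bar>Bw * B\<psi>\<bar> + \<bar>BD\<bar>" for r by (rule fB)
      fix r assume r: "r \<in> {0<..<1} - ?S"
      have "has_partial F v (f (z + r *\<^sub>R v)) (z + r *\<^sub>R v)"
      proof (cases "z + r *\<^sub>R v \<in> K")
        case True
        then have "has_partial u v (w (z + r *\<^sub>R v)) (z + r *\<^sub>R v)" using r K(2) by blast
        then show ?thesis
          unfolding F_def f_def by (rule has_partial_mult[OF _ test_function_has_partial[OF \<psi>]])
      next
        case False
        have "has_partial (\<lambda>_. 0) v 0 (z + r *\<^sub>R v)" by (simp add: has_partial_def)
        then show ?thesis
          using False K(3,4) by (subst has_partial_cong[OF open_K, where g = "\<lambda>_. 0"]) (auto simp: F_def f_def)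
      qed
      then show "((\<lambda>r. F (z + r *\<^sub>R v)) has_real_derivative f (z + r *\<^sub>R v)) (at r)"
        by (simp add: has_partial_shift)
    qed
    then show "(LINT r:{0..1}|lborel. f (z + r *\<^sub>R v)) = F (z + v) - F z" by simp
  qed
  then have "(LINT z|lborel. u z * ?D z) = - (LINT z|lborel. w z * \<psi> z)"
    unfolding f_def using int1 int2 by simp
  moreover have "(LINT z:\<Omega>|lebesgue. u z * ?D z) = (LINT z|lborel. u z * ?D z)"
    using K(2,4) by (intro set_integral_lebesgue_eq_lborel) auto
  moreover have "(LINT z:\<Omega>|lebesgue. w z * \<psi> z) = (LINT z|lborel. w z * \<psi> z)"
    using K(2,3) by (intro set_integral_lebesgue_eq_lborel) auto
  ultimately show "(LINT z:\<Omega>|lebesgue. u z * ?D z) = - (LINT z:\<Omega>|lebesgue. w z * \<psi> z)"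
    by simp
qed

section \<open>The one-dimensional building blocks\<close>

definition profile :: "real \<Rightarrow> real \<Rightarrow> real" where
  "profile y t = max (y\<^sup>2) (hh t)"

text \<open>For \<open>t > 0\<close>, a continuous selection from the sign of the slope of the profile. On the facet it is linear, which makes
  its derivative constant in \<open>y\<close>, as needed for the facet to stay flat.\<close>

definition flux :: "real \<Rightarrow> real \<Rightarrow> real" where
  "flux y t = max (-1) (min 1 (y / xi t))"

definition slope :: "real \<Rightarrow> real \<Rightarrow> real" where
  "slope y t = (if \<bar>y\<bar> \<le> xi t then 0 else 2 * y)"

text \<open>For \<open>t > 0\<close> and off the fronts, this is both the time derivative of the profile and the space derivative of the flux.\<close>

definition speed :: "real \<Rightarrow> real \<Rightarrow> real" where
  "speed y t = (if \<bar>y\<bar> < xi t then 1 / xi t else 0)"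

lemma xi_nonneg: "0 \<le> xi t"
  by (simp add: xi_def)

lemma xi_pos: "t > 0 \<Longrightarrow> 0 < xi t"
  by (simp add: xi_def)

lemma xi_cube: "t \<ge> 0 \<Longrightarrow> xi t ^ 3 = 3 / 2 * t"
  by (cases "t = 0") (simp_all add: xi_def power_mult_distrib powr_power)

lemma less_xi_iff: "t \<ge> 0 \<Longrightarrow> \<bar>y\<bar> < xi t \<longleftrightarrow> 2 / 3 * \<bar>y\<bar> ^ 3 < t"
  using power_strict_mono[of "\<bar>y\<bar>" "xi t" 3] power_mono[of "xi t" "\<bar>y\<bar>" 3] xi_cube[of t] xi_nonneg[of t]
  by (force simp: not_less[symmetric])

lemma xi_less_iff: "t \<ge> 0 \<Longrightarrow> xi t < \<bar>y\<bar> \<longleftrightarrow> t < 2 / 3 * \<bar>y\<bar> ^ 3"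
  using power_strict_mono[of "xi t" "\<bar>y\<bar>" 3] power_mono[of "\<bar>y\<bar>" "xi t" 3] xi_cube[of t] xi_nonneg[of t]
  by (force simp: not_less[symmetric])

lemma continuous_on_xi: "continuous_on {0..} xi"
  unfolding xi_def by (intro continuous_intros continuous_on_powr') auto

lemma borel_measurable_xi [measurable]: "xi \<in> borel_measurable borel"
  unfolding xi_def by measurable

text \<open>The comparison behind \<open>max\<close> in the profile is the case distinction in the definition of \<open>u\<close>.\<close>

lemma power2_le_hh_iff: "y\<^sup>2 \<le> hh t \<longleftrightarrow> \<bar>y\<bar> \<le> xi t"
  unfolding hh_def using abs_le_square_iff[of y "xi t"] xi_nonneg[of t] by simp

text \<open>Differentiating \<open>\<xi>\<^sup>3 = 3t/2\<close> gives \<open>2\<xi>\<^sup>2\<xi>' = 1\<close>, that is \<open>h' = 2\<xi>\<xi>' = 1 / \<xi>\<close>.\<close>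

lemma has_derivative_hh:
  assumes "t > 0"
  shows "(hh has_real_derivative 1 / xi t) (at t)"
proof -
  obtain D where D: "(xi has_real_derivative D) (at t)"
    using DERIV_cmult[OF has_real_derivative_powr[OF assms, of "1 / 3"], of "(3 / 2) powr (1 / 3)"]
    unfolding xi_def by blast
  have "((\<lambda>t. xi t ^ 3) has_real_derivative 3 * (xi t)\<^sup>2 * D) (at t)"
    by (auto intro!: derivative_eq_intros D)
  moreover have "((\<lambda>t. xi t ^ 3) has_real_derivative 3 / 2) (at t)"
  proof (rule has_field_derivative_transform_within_open[of "\<lambda>t. 3 / 2 * t" _ _ "{0<..}"])
    show "((*) (3 / 2) has_real_derivative 3 / 2) (at t)"
      by (auto intro!: derivative_eq_intros)
  qed (use assms xi_cube in auto)
  ultimately have "3 * (xi t)\<^sup>2 * D = 3 / 2" by (rule DERIV_unique)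
  then have "2 * xi t * D = 1 / xi t"
    using xi_pos[OF assms] by (simp add: field_simps power2_eq_square)
  moreover have "((\<lambda>t. (xi t)\<^sup>2) has_real_derivative 2 * xi t * D) (at t)"
    by (auto intro!: derivative_eq_intros D)
  ultimately show ?thesis unfolding hh_def by metis
qed

text \<open>Both \<open>h = \<xi>\<^sup>2\<close> and \<open>3t/2 = \<xi>\<^sup>3\<close> are powers of \<open>\<xi>\<close>. Factoring \<open>p - q\<close> out of \<open>p\<^sup>2 - q\<^sup>2\<close> and of
  \<open>p\<^sup>3 - q\<^sup>3\<close> compares the two differences without calculus.\<close>

lemma hh_Lipschitz_estimate:
  assumes "t \<ge> 0" "t' \<ge> 0" "m \<le> xi t" "m \<le> xi t'"
  shows "\<bar>hh t - hh t'\<bar> * m \<le> 3 / 2 * \<bar>t - t'\<bar>"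
proof -
  let ?p = "xi t" and ?q = "xi t'"
  have "\<bar>hh t - hh t'\<bar> * m = \<bar>?p - ?q\<bar> * ((?p + ?q) * m)"
  proof -
    have "hh t - hh t' = (?p - ?q) * (?p + ?q)" by (simp add: hh_def power2_eq_square algebra_simps)
    then show ?thesis using xi_nonneg[of t] xi_nonneg[of t'] by (simp add: abs_mult)
  qed
  also have "(?p + ?q) * m \<le> ?p * ?p + ?p * ?q + ?q * ?q"
    using mult_left_mono[OF assms(3) xi_nonneg[of t]] mult_left_mono[OF assms(4) xi_nonneg[of t']]
      mult_nonneg_nonneg[OF xi_nonneg[of t] xi_nonneg[of t']] by (simp add: algebra_simps)
  also have "\<bar>?p - ?q\<bar> * (?p * ?p + ?p * ?q + ?q * ?q) = \<bar>?p ^ 3 - ?q ^ 3\<bar>"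
  proof -
    have "?p ^ 3 - ?q ^ 3 = (?p - ?q) * (?p * ?p + ?p * ?q + ?q * ?q)"
      by (simp add: power3_eq_cube algebra_simps)
    then show ?thesis using xi_nonneg[of t] xi_nonneg[of t'] by (simp add: abs_mult)
  qed
  also have "\<dots> = 3 / 2 * \<bar>t - t'\<bar>" 
    unfolding xi_cube[OF assms(1)] xi_cube[OF assms(2)] by (auto simp: abs_if)
  finally show ?thesis by (simp add: mult_left_mono)
qed

lemma profile_diff: "\<bar>profile y t - profile y' t'\<bar> \<le> \<bar>y\<^sup>2 - y'\<^sup>2\<bar> + \<bar>hh t - hh t'\<bar>"
  unfolding profile_def by linarith

lemma profile_has_derivative_time:
  assumes t: "t > 0" and y: "\<bar>y\<bar> \<noteq> xi t"
  shows "(profile y has_real_derivative speed y t) (at t)"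
proof (cases "\<bar>y\<bar> < xi t")
  case True
  have "(profile y has_real_derivative 1 / xi t) (at t)"
  proof (rule has_field_derivative_transform_within_open[OF has_derivative_hh[OF t]])
    show "open {2 / 3 * \<bar>y\<bar> ^ 3 <..}" by simp
    show "t \<in> {2 / 3 * \<bar>y\<bar> ^ 3 <..}" using True t by (simp add: less_xi_iff)
    show "hh s = profile y s" if "s \<in> {2 / 3 * \<bar>y\<bar> ^ 3 <..}" for s
    proof -
      have "0 \<le> 2 / 3 * \<bar>y\<bar> ^ 3" by simp
      moreover have "2 / 3 * \<bar>y\<bar> ^ 3 < s" using that by simp
      ultimately have "s \<ge> 0" by linarith
      then have "\<bar>y\<bar> < xi s" using that by (simp add: less_xi_iff)
      then show ?thesis using power2_le_hh_iff[of y s] by (simp add: profile_def)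
    qed
  qed
  then show ?thesis using True by (simp add: speed_def)
next
  case False
  have "(profile y has_real_derivative 0) (at t)"
  proof (rule has_field_derivative_transform_within_open[of "\<lambda>_. y\<^sup>2"])
    show "open {0<..<2 / 3 * \<bar>y\<bar> ^ 3}" by simp
    show "t \<in> {0<..<2 / 3 * \<bar>y\<bar> ^ 3}" using False y t xi_less_iff[of t y] by simp
    show "y\<^sup>2 = profile y s" if "s \<in> {0<..<2 / 3 * \<bar>y\<bar> ^ 3}" for s
    proof -
      have "xi s < \<bar>y\<bar>" using that by (simp add: xi_less_iff)
      then show ?thesis using power2_le_hh_iff[of y s] by (simp add: profile_def)
    qed
  qed simp
  then show ?thesis using False by (simp add: speed_def)
qed

lemma profile_has_derivative_space:
  assumes y: "\<bar>y\<bar> \<noteq> xi t"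
  shows "((\<lambda>y. profile y t) has_real_derivative slope y t) (at y)"
proof (cases "\<bar>y\<bar> < xi t")
  case True
  have "((\<lambda>y. profile y t) has_real_derivative 0) (at y)"
  proof (rule has_field_derivative_transform_within_open[of "\<lambda>_. hh t"])
    show "open {- xi t<..<xi t}" by simp
    show "y \<in> {- xi t<..<xi t}" using True by auto
    show "hh t = profile s t" if "s \<in> {- xi t<..<xi t}" for s
      using that power2_le_hh_iff[of s t] by (auto simp: profile_def abs_le_iff)
  qed simp
  then show ?thesis using True by (simp add: slope_def)
next
  case False
  have "((\<lambda>y. profile y t) has_real_derivative 2 * y) (at y)"
  proof (rule has_field_derivative_transform_within_open[of "\<lambda>y. y\<^sup>2"])
    show "((\<lambda>y. y\<^sup>2) has_real_derivative 2 * y) (at y)" by (auto intro!: derivative_eq_intros)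
    show "open {s. xi t < \<bar>s\<bar>}" by (intro open_Collect_less continuous_intros)
    show "y \<in> {s. xi t < \<bar>s\<bar>}" using False y by simp
    show "s\<^sup>2 = profile s t" if "s \<in> {s. xi t < \<bar>s\<bar>}" for s
      using that power2_le_hh_iff[of s t] by (simp add: profile_def)
  qed
  then show ?thesis using False y by (simp add: slope_def)
qed

text \<open>At a front, the profile touches the constant \<open>h\<close> and the parabola \<open>y\<^sup>2\<close> from above. A derivative would
  have to agree with both of their slopes, \<open>0\<close> and \<open>2y\<close>.\<close>

lemma profile_not_differentiable_at_front:
  assumes t: "t > 0" and y: "\<bar>y\<bar> = xi t"
  shows "\<not> ((\<lambda>y. profile y t) has_real_derivative d) (at y)"
proof
  assume D: "((\<lambda>y. profile y t) has_real_derivative d) (at y)"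
  have eq: "profile y t = hh t" "profile y t = y\<^sup>2"
    using y by (auto simp: profile_def hh_def simp flip: y)
  have "d = 0"
    by (rule DERIV_local_min[OF D zero_less_one]) (simp add: eq(1), simp add: profile_def)
  moreover have "((\<lambda>s. profile s t - s\<^sup>2) has_real_derivative d - 2 * y) (at y)"
    by (auto intro!: derivative_eq_intros D)
  then have "d - 2 * y = 0"
    by (rule DERIV_local_min[OF _ zero_less_one]) (simp add: eq(2), simp add: profile_def)
  ultimately show False using y xi_pos[OF t] by simp
qed

lemma flux_has_derivative_space:
  assumes t: "t > 0" and y: "\<bar>y\<bar> \<noteq> xi t"
  shows "((\<lambda>y. flux y t) has_real_derivative speed y t) (at y)"
proof -
  note pos = xi_pos[OF t]
  consider "\<bar>y\<bar> < xi t" | "xi t < y" | "y < - xi t" using y by linarith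
  then show ?thesis
  proof cases
    case 1
    have "((\<lambda>y. flux y t) has_real_derivative 1 / xi t) (at y)"
    proof (rule has_field_derivative_transform_within_open[of "\<lambda>y. y / xi t"])
      show "((\<lambda>y. y / xi t) has_real_derivative 1 / xi t) (at y)"
        using pos by (auto intro!: derivative_eq_intros)
      show "open {- xi t<..<xi t}" by simp
      show "y \<in> {- xi t<..<xi t}" using 1 by auto
      show "s / xi t = flux s t" if "s \<in> {- xi t<..<xi t}" for s
        using that pos by (auto simp: flux_def max_def min_def field_simps)
    qed
    then show ?thesis using 1 by (simp add: speed_def)
  next
    case 2
    have "((\<lambda>y. flux y t) has_real_derivative 0) (at y)"
    proof (rule has_field_derivative_transform_within_open[of "\<lambda>_. 1"])
      show "y \<in> {xi t<..}" using 2 by simp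
      show "1 = flux s t" if "s \<in> {xi t<..}" for s
        using that pos by (auto simp: flux_def max_def min_def field_simps)
    qed simp_all
    then show ?thesis using 2 pos by (simp add: speed_def)
  next
    case 3
    have "((\<lambda>y. flux y t) has_real_derivative 0) (at y)"
    proof (rule has_field_derivative_transform_within_open[of "\<lambda>_. -1"])
      show "y \<in> {..<- xi t}" using 3 by simp
      show "-1 = flux s t" if "s \<in> {..<- xi t}" for s
        using that pos by (auto simp: flux_def max_def min_def field_simps)
    qed simp_all
    then show ?thesis using 3 pos by (simp add: speed_def)
  qed
qed

lemma flux_in_multi_sgn:
  assumes "t > 0"
  shows "flux y t \<in> multi_sgn (slope y t)"
  using xi_pos[OF assms]
  by (auto simp: flux_def slope_def multi_sgn_def max_def min_def field_simps abs_le_iff)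

lemma abs_flux_le: "\<bar>flux y t\<bar> \<le> 1"
  by (simp add: flux_def)

lemma abs_speed_le: "\<bar>speed y t\<bar> \<le> 1 / xi t"
  using xi_nonneg[of t] by (simp add: speed_def)

lemma u_sol_eq: "u_sol R (x, t) = (\<Sum>i\<in>UNIV. profile (x $ i) t) - 2 * R\<^sup>2"
  by (auto simp: sum_2 profile_def max_def power2_le_hh_iff)

section \<open>Pointwise validity and the exceptional set\<close>

lemma has_real_derivative_add_const_iff:
  "((\<lambda>s. f s + c) has_real_derivative d) (at a) \<longleftrightarrow> (f has_real_derivative d) (at a)"
  using DERIV_add[of f d a UNIV "\<lambda>_. c" 0] DERIV_add[of "\<lambda>s. f s + c" d a UNIV "\<lambda>_. -c" 0] by auto

lemma has_partial_u_sol_space_iff: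
  "has_partial (u_sol R) (e_space i) d (x, t) \<longleftrightarrow> ((\<lambda>y. profile y t) has_real_derivative d) (at (x $ i))"
proof -
  define c where "c = (\<Sum>j\<in>UNIV - {i}. profile (x $ j) t) - 2 * R\<^sup>2"
  have "u_sol R ((x, t) + s *\<^sub>R e_space i) = profile (s + x $ i) t + c" for s
  proof -
    have "(\<Sum>j\<in>UNIV - {i}. profile ((x + s *\<^sub>R axis i 1) $ j) t) = (\<Sum>j\<in>UNIV - {i}. profile (x $ j) t)"
      by (rule sum.cong) (auto simp: axis_def)
    then show ?thesis
      unfolding e_space_def c_def
      by (simp add: u_sol_eq sum.remove[of UNIV i] add.commute[of _ s] del: u_sol.simps)
  qed
  then show ?thesis
    unfolding has_partial_def
    using DERIV_shift[of "\<lambda>y. profile y t" d 0 "x $ i"]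
    by (simp add: has_real_derivative_add_const_iff del: u_sol.simps)
qed

lemma has_partial_u_sol_time:
  assumes "t > 0" "\<And>i. \<bar>x $ i\<bar> \<noteq> xi t"
  shows "has_partial (u_sol R) e_time (\<Sum>i\<in>UNIV. speed (x $ i) t) (x, t)"
proof -
  have "((\<lambda>s. (\<Sum>i\<in>UNIV. profile (x $ i) s) + - 2 * R\<^sup>2) has_real_derivative
      (\<Sum>i\<in>UNIV. speed (x $ i) t)) (at (0 + t))"
    unfolding has_real_derivative_add_const_iff
    using assms by (intro DERIV_sum) (simp add: profile_has_derivative_time)
  then show ?thesis
    unfolding DERIV_shift has_partial_def e_time_def
    by (simp add: u_sol_eq add.commute del: u_sol.simps)
qed

lemma has_partial_flux:
  assumes "t > 0" "\<bar>x $ i\<bar> \<noteq> xi t"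
  shows "has_partial (\<lambda>w. flux (fst w $ i) (snd w)) (e_space i) (speed (x $ i) t) (x, t)"
  using DERIV_shift[of "\<lambda>y. flux y t" "speed (x $ i) t" 0 "x $ i"]
    flux_has_derivative_space[OF assms]
  unfolding has_partial_def e_space_def by (simp add: add.commute)

definition sigma_field :: "spacetime \<Rightarrow> real^2" where
  "sigma_field z = (\<chi> i. flux (fst z $ i) (snd z))"

text \<open>Off the fronts, the time derivative and the divergence are the same sum of speeds. On a front, already the
  space derivative of \<open>u\<close> is missing.\<close>

lemma satisfied_pointwise_iff:
  assumes t: "t > 0"
  shows "satisfied_pointwise sigma_field (u_sol R) (x, t) \<longleftrightarrow> (\<forall>i. \<bar>x $ i\<bar> \<noteq> xi t)"
proof
  assume "satisfied_pointwise sigma_field (u_sol R) (x, t)"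
  then show "\<forall>i. \<bar>x $ i\<bar> \<noteq> xi t"
    unfolding satisfied_pointwise_def has_partial_u_sol_space_iff
    using profile_not_differentiable_at_front[OF t] by blast
next
  assume x: "\<forall>i. \<bar>x $ i\<bar> \<noteq> xi t"
  show "satisfied_pointwise sigma_field (u_sol R) (x, t)"
    unfolding satisfied_pointwise_def
  proof (intro conjI allI exI)
    fix i
    show "has_partial (u_sol R) (e_space i) (slope (x $ i) t) (x, t)"
      unfolding has_partial_u_sol_space_iff using x by (intro profile_has_derivative_space) auto
    show "sigma_field (x, t) $ i \<in> multi_sgn (slope (x $ i) t)"
      using flux_in_multi_sgn[OF t] by (simp add: sigma_field_def)
    show "has_partial (\<lambda>w. sigma_field w $ i) (e_space i) (speed (x $ i) t) (x, t)"
      using has_partial_flux[OF t, of x i] x by (simp add: sigma_field_def)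
    show "has_partial (u_sol R) e_time (\<Sum>i\<in>UNIV. speed (x $ i) t) (x, t)"
      using x by (intro has_partial_u_sol_time[OF t]) auto
  qed (rule refl)
qed

lemma hausdorff_measure_coordinate_line_null:
  fixes i :: 2
  assumes s: "s > 1"
  shows "hausdorff_measure s {x::real^2. x $ i = c} = 0"
proof -
  obtain k where k: "k \<noteq> i" "\<And>j. j = i \<or> j = k"
    using exhaust_2 by (metis zero_neq_one)
  let ?f = "\<lambda>r. c *\<^sub>R axis i 1 + r *\<^sub>R axis k 1 :: real^2"
  let ?g = "\<lambda>r. c *\<^sub>R axis i 1 + (- r) *\<^sub>R axis k 1 :: real^2"
  have lip: "1-lipschitz_on UNIV ?f" "1-lipschitz_on UNIV ?g"
    by (auto intro!: lipschitz_onI simp: dist_norm norm_axis_1 simp flip: scaleR_diff_left scaleR_minus_left)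
  have "{x. x $ i = c} = ?f ` {0..} \<union> ?g ` {0..}"
  proof (intro equalityI subsetI)
    fix x :: "real^2" assume "x \<in> {x. x $ i = c}"
    then have "x = ?f (x $ k)" "x = ?g (- x $ k)"
      using k by (auto simp: vec_eq_iff axis_def)
    then show "x \<in> ?f ` {0..} \<union> ?g ` {0..}"
      using image_eqI[of x ?f "x $ k" "{0..}"] image_eqI[of x ?g "- x $ k" "{0..}"]
      by (cases "x $ k \<ge> 0") (simp_all del: scaleR_minus_left)
  next
    fix x assume "x \<in> ?f ` {0..} \<union> ?g ` {0..}"
    then show "x \<in> {x. x $ i = c}" using k(1) by (auto simp: axis_def)
  qed
  then show ?thesis
    using hausdorff_measure_Un_null[OF hausdorff_measure_ray_null[OF lip(1) s] hausdorff_measure_ray_null[OF lip(2) s]]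
    by simp
qed

lemma exists_2: "(\<exists>i::2. P i) \<longleftrightarrow> P 1 \<or> P 2"
  using forall_2[of "\<lambda>i. \<not> P i"] by blast

lemma hausdorff_dim_front: "hausdorff_dim {x::real^2. \<exists>i. \<bar>x $ i\<bar> = r} = 1" if "r \<ge> 0"
proof (rule hausdorff_dim_eq_1I)
  have eq: "{x::real^2. \<exists>i. \<bar>x $ i\<bar> = r} = ({x. x $ 1 = r} \<union> {x. x $ 1 = - r}) \<union> ({x. x $ 2 = r} \<union> {x. x $ 2 = - r})"
    using that by (auto simp: exists_2 abs_if)
  show "hausdorff_measure s {x::real^2. \<exists>i. \<bar>x $ i\<bar> = r} = 0" if "s > 1" for s
    unfolding eq by (intro hausdorff_measure_Un_null hausdorff_measure_coordinate_line_null that)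
  show "hausdorff_measure s {x::real^2. \<exists>i. \<bar>x $ i\<bar> = r} \<noteq> 0" if s: "0 < s" "s < 1" for s
  proof (rule hausdorff_measure_nonzero_if_projection[where p = "\<lambda>x. x $ 2"])
    show "1-lipschitz_on UNIV (\<lambda>x::real^2. x $ 2)"
      by (auto intro!: lipschitz_onI dist_vec_nth_le)
    show "{0..1} \<subseteq> (\<lambda>x. x $ 2) ` {x::real^2. \<exists>i. \<bar>x $ i\<bar> = r}"
    proof
      fix a :: real
      have "a = vector [r, a] $ (2::2)" "\<bar>vector [r, a] $ (1::2)\<bar> = r"
        using \<open>r \<ge> 0\<close> by (simp_all add: vector_2)
      then show "a \<in> (\<lambda>x. x $ 2) ` {x::real^2. \<exists>i. \<bar>x $ i\<bar> = r}" by (intro image_eqI[of _ _ "vector [r, a]"]) blast+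
    qed
  qed (use s in auto)
qed

section \<open>The weak formulation\<close>

lemma borel_measurable_coordinate [measurable]:
  "(\<lambda>z::spacetime. fst z $ i) \<in> borel_measurable borel"
  "(\<lambda>z::spacetime. snd z) \<in> borel_measurable borel"
  by (intro borel_measurable_continuous_onI continuous_intros)+

lemma open_upper: "open (UNIV \<times> {0<..} :: spacetime set)"
  by (intro open_Times) auto

lemma continuous_on_xi_snd: "continuous_on (UNIV \<times> {0<..}) (\<lambda>z::spacetime. xi (snd z))"
  by (rule continuous_on_compose2[OF continuous_on_xi]) (auto intro!: continuous_intros)

lemma continuous_on_inverse_xi: "continuous_on (UNIV \<times> {0<..}) (\<lambda>z::spacetime. 1 / xi (snd z))"
  using xi_pos by (intro continuous_intros continuous_on_xi_snd) force

lemma continuous_on_u_sol: "continuous_on (UNIV \<times> {0..}) (u_sol R)"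
proof -
  have "continuous_on (UNIV \<times> {0..}) (\<lambda>z::spacetime. xi (snd z))"
    by (rule continuous_on_compose2[OF continuous_on_xi]) (auto intro!: continuous_intros)
  then have "continuous_on (UNIV \<times> {0..}) (\<lambda>z::spacetime. (\<Sum>i\<in>UNIV. profile (fst z $ i) (snd z)) - 2 * R\<^sup>2)"
    unfolding profile_def hh_def by (intro continuous_intros)
  moreover have "u_sol R z = (\<Sum>i\<in>UNIV. profile (fst z $ i) (snd z)) - 2 * R\<^sup>2" for z
    using u_sol_eq[of R "fst z" "snd z"] by (simp del: u_sol.simps)
  ultimately show ?thesis by simp
qed

text \<open>Local boundedness of the discontinuous functions \<open>speed\<close> and \<open>slope\<close> follows from continuous majorants.\<close>

lemma bounded_image_dominated:
  fixes k g :: "'a::metric_space \<Rightarrow> real"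
  assumes "compact K" "continuous_on K g" "\<And>z. z \<in> K \<Longrightarrow> \<bar>k z\<bar> \<le> g z"
  shows "bounded (k ` K)"
proof -
  have "bounded (g ` K)" using assms(1,2) by (intro compact_imp_bounded compact_continuous_image)
  then obtain B where "\<And>z. z \<in> K \<Longrightarrow> \<bar>g z\<bar> \<le> B" by (auto simp: bounded_iff)
  then have "\<And>z. z \<in> K \<Longrightarrow> \<bar>k z\<bar> \<le> B" using assms(3) by fastforce
  then show ?thesis by (auto simp: bounded_iff)
qed

text \<open>A vertical line over \<open>x\<close> crosses the fronts only at the times \<open>2/3 |x\<^sub>i|\<^sup>3\<close>.\<close>

lemma u_sol_weak_time_derivative:
  "has_weak_partial_on (UNIV \<times> {0<..}) (u_sol R) e_time (\<lambda>z. \<Sum>i\<in>UNIV. speed (fst z $ i) (snd z))"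
proof (rule has_weak_partial_onI[OF open_upper])
  show "continuous_on (UNIV \<times> {0<..}) (u_sol R)"
    by (rule continuous_on_subset[OF continuous_on_u_sol]) auto
  show "(\<lambda>z::spacetime. \<Sum>i\<in>UNIV. speed (fst z $ i) (snd z)) \<in> borel_measurable borel"
    unfolding speed_def by measurable
  show "bounded ((\<lambda>z::spacetime. \<Sum>i\<in>UNIV. speed (fst z $ i) (snd z)) ` K)"
    if K: "compact K" "K \<subseteq> UNIV \<times> {0<..}" for K
  proof (rule bounded_image_dominated[OF K(1)])
    show "continuous_on K (\<lambda>z::spacetime. \<Sum>i\<in>(UNIV::2 set). 1 / xi (snd z))"
      by (intro continuous_on_sum continuous_on_subset[OF continuous_on_inverse_xi] K)
    show "\<bar>\<Sum>i\<in>UNIV. speed (fst z $ i) (snd z)\<bar> \<le> (\<Sum>i\<in>(UNIV::2 set). 1 / xi (snd z))" for z :: spacetime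
      by (intro order_trans[OF sum_abs] sum_mono abs_speed_le)
  qed
  fix z :: spacetime
  obtain x t where z: "z = (x, t)" by (cases z)
  show "finite {r. z + r *\<^sub>R e_time \<in> UNIV \<times> {0<..} \<and>
    \<not> has_partial (u_sol R) e_time (\<Sum>i\<in>UNIV. speed (fst (z + r *\<^sub>R e_time) $ i) (snd (z + r *\<^sub>R e_time)))
       (z + r *\<^sub>R e_time)}" (is "finite ?S")
  proof (rule finite_subset)
    show "finite (range (\<lambda>i. 2 / 3 * \<bar>x $ i\<bar> ^ 3 - t))" by simp
    show "?S \<subseteq> range (\<lambda>i. 2 / 3 * \<bar>x $ i\<bar> ^ 3 - t)"
    proof
      fix r assume "r \<in> ?S"
      then have r: "t + r > 0"
        "\<not> has_partial (u_sol R) e_time (\<Sum>i\<in>UNIV. speed (x $ i) (t + r)) (x, t + r)"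
        by (auto simp: z e_time_def)
      then obtain i where "\<bar>x $ i\<bar> = xi (t + r)" using has_partial_u_sol_time by blast
      then have "r = 2 / 3 * \<bar>x $ i\<bar> ^ 3 - t" using xi_cube[of "t + r"] r(1) by simp
      then show "r \<in> range (\<lambda>i. 2 / 3 * \<bar>x $ i\<bar> ^ 3 - t)" by blast
    qed
  qed
qed

lemma finite_front_crossings: "finite {r. \<bar>a + r\<bar> = (c::real)}"
  by (rule finite_subset[of _ "{c - a, - c - a}"]) auto

lemma spacetime_add_e_space:
  "fst (z + r *\<^sub>R e_space i) $ i = fst z $ i + r" "snd (z + r *\<^sub>R e_space i) = snd z"
  by (simp_all add: e_space_def)

lemma u_sol_weak_space_derivative:
  "has_weak_partial_on (UNIV \<times> {0<..}) (u_sol R) (e_space i) (\<lambda>z. slope (fst z $ i) (snd z))"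
proof (rule has_weak_partial_onI[OF open_upper])
  show "continuous_on (UNIV \<times> {0<..}) (u_sol R)"
    by (rule continuous_on_subset[OF continuous_on_u_sol]) auto
  show "(\<lambda>z::spacetime. slope (fst z $ i) (snd z)) \<in> borel_measurable borel"
    unfolding slope_def by measurable
  show "bounded ((\<lambda>z::spacetime. slope (fst z $ i) (snd z)) ` K)" if "compact K" for K
    by (rule bounded_image_dominated[OF that, of "\<lambda>z. 2 * \<bar>fst z $ i\<bar>"])
       (auto intro!: continuous_intros simp: slope_def)
  fix z :: spacetime
  show "finite {r. z + r *\<^sub>R e_space i \<in> UNIV \<times> {0<..} \<and>
    \<not> has_partial (u_sol R) (e_space i) (slope (fst (z + r *\<^sub>R e_space i) $ i) (snd (z + r *\<^sub>R e_space i)))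
       (z + r *\<^sub>R e_space i)}" (is "finite ?S")
  proof (rule finite_subset[OF _ finite_front_crossings])
    show "?S \<subseteq> {r. \<bar>fst z $ i + r\<bar> = xi (snd z)}"
    proof
      fix r assume r: "r \<in> ?S"
      let ?w = "z + r *\<^sub>R e_space i"
      have "\<not> has_partial (u_sol R) (e_space i) (slope (fst ?w $ i) (snd ?w)) (fst ?w, snd ?w)"
        using r unfolding prod.collapse by blast
      then have "\<bar>fst ?w $ i\<bar> = xi (snd ?w)"
        unfolding has_partial_u_sol_space_iff using profile_has_derivative_space by blast
      then show "r \<in> {r. \<bar>fst z $ i + r\<bar> = xi (snd z)}"
        unfolding spacetime_add_e_space by simp
    qed
  qed
qed

lemma integrable_lborel_product:
  fixes a :: "'a::euclidean_space \<Rightarrow> real" and b :: "'b::euclidean_space \<Rightarrow> real"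
  assumes a: "integrable lborel a" and b: "integrable lborel b"
  shows "integrable lborel (\<lambda>z. a (fst z) * b (snd z))"
proof -
  have [measurable]: "a \<in> borel_measurable borel" "b \<in> borel_measurable borel" using a b by auto
  have "integrable (lborel \<Otimes>\<^sub>M lborel) (\<lambda>(x, t). a x * b t)"
  proof (rule lborel_pair.Fubini_integrable)
    show "integrable lborel (\<lambda>x. LINT t|lborel. norm (case (x, t) of (x, t) \<Rightarrow> a x * b t))"
      using a by (simp add: abs_mult)
    show "AE x in lborel. integrable lborel (\<lambda>t. case (x, t) of (x, t) \<Rightarrow> a x * b t)"
      using b by simp
  qed measurable
  then show ?thesis by (simp add: lborel_prod case_prod_unfold)
qed

lemma integrable_inverse_xi:
  assumes "T > 0"
  shows "integrable lborel (\<lambda>t. indicator {0..T} t * (1 / xi t))"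
proof -
  have "(\<lambda>t. t powr (- 1 / 3)) absolutely_integrable_on {0..T}"
    using assms by (subst absolutely_integrable_on_iff_nonneg) (auto intro!: integrable_on_powr_from_0)
  then have "integrable lebesgue (\<lambda>t. ((3 / 2) powr (- 1 / 3)) * (indicator {0..T} t *\<^sub>R t powr (- 1 / 3)))"
    unfolding set_integrable_def by (rule integrable_mult_right)
  then have "integrable lborel (\<lambda>t. ((3 / 2) powr (- 1 / 3)) * (indicator {0..T} t *\<^sub>R t powr (- 1 / 3)))"
    by (subst (asm) integrable_completion) auto
  also have "(\<lambda>t. ((3 / 2) powr (- 1 / 3)) * (indicator {0..T} t *\<^sub>R t powr (- 1 / 3)))
      = (\<lambda>t. indicator {0..T} t * (1 / xi t))"
    by (auto simp: fun_eq_iff xi_def powr_minus field_simps)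
  finally show ?thesis .
qed

text \<open>The integrand is the \<open>x\<^sub>i\<close>-derivative of \<open>flux x\<^sub>i t \<cdot> \<phi>\<close>, restricted to \<open>0 < t < T\<close>. This restriction does
  not disturb the argument, because \<open>t\<close> is constant along lines in the direction of \<open>x\<^sub>i\<close>; for the same
  reason the speed, though unbounded as \<open>t \<rightarrow> 0\<close>, is bounded on each of these lines.\<close>

lemma flux_divergence_theorem:
  fixes i :: 2
  assumes T: "T > 0" and \<phi>: "\<phi> \<in> test_functions (UNIV \<times> {..<T})"
  defines "f \<equiv> \<lambda>z. indicator (UNIV \<times> {0<..<T}) z * (speed (fst z $ i) (snd z) * \<phi> z
      + flux (fst z $ i) (snd z) * frechet_derivative \<phi> (at z) (e_space i))"
  shows "integrable lborel f" "integral\<^sup>L lborel f = 0"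
proof -
  let ?D = "\<lambda>z. frechet_derivative \<phi> (at z) (e_space i)"
  let ?I = "indicator (UNIV \<times> {0<..<T}) :: spacetime \<Rightarrow> real"
  obtain K where K: "compact K" "\<And>z. z \<notin> K \<Longrightarrow> \<phi> z = 0"
    "\<And>z v. z \<notin> K \<Longrightarrow> frechet_derivative \<phi> (at z) v = 0"
    by (rule test_function_support[OF \<phi>]) blast
  note cont = test_function_continuous[OF \<phi>]
  have bounded_on_K: "\<exists>B. \<forall>z\<in>K. \<bar>k z\<bar> \<le> B" if "continuous_on UNIV k" for k :: "spacetime \<Rightarrow> real"
    using compact_imp_bounded[OF compact_continuous_image[OF continuous_on_subset[OF that] K(1)]]
    by (auto simp: bounded_iff)
  obtain B where B: "\<And>z. z \<in> K \<Longrightarrow> \<bar>\<phi> z\<bar> \<le> B" using bounded_on_K[OF cont(1)] by blast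
  obtain B' where B': "\<And>z. z \<in> K \<Longrightarrow> \<bar>?D z\<bar> \<le> B'" using bounded_on_K[OF cont(2)] by blast
  have B_all: "\<bar>\<phi> z\<bar> \<le> \<bar>B\<bar>" "\<bar>?D z\<bar> \<le> \<bar>B'\<bar>" for z
    using B[of z] B'[of z] K(2)[of z] K(3)[of z "e_space i"] by (cases "z \<in> K"; force)+
  note [measurable] = borel_measurable_continuous_onI[OF cont(1)]
    borel_measurable_continuous_onI[OF cont(2)]
  have [measurable]: "UNIV \<times> {0<..<T} \<in> sets (borel :: spacetime measure)"
    by (intro borel_open open_Times) auto
  have [measurable]: "(\<lambda>z::spacetime. flux (fst z $ i) (snd z)) \<in> borel_measurable borel"
    "(\<lambda>z::spacetime. speed (fst z $ i) (snd z)) \<in> borel_measurable borel"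
    unfolding flux_def speed_def by measurable
  define F where "F z = ?I z * (flux (fst z $ i) (snd z) * \<phi> z)" for z
  have I_le: "\<bar>?I z * q\<bar> \<le> \<bar>q\<bar>" for z q by (simp add: indicator_def)
  have int_F: "integrable lborel F"
  proof (rule integrable_lborel_bounded_support[OF _ K(1)])
    show "F \<in> borel_measurable borel" unfolding F_def by measurable
    show "\<bar>F z\<bar> \<le> 1 * \<bar>B\<bar>" for z
      unfolding F_def by (rule order_trans[OF I_le])
        (unfold abs_mult, intro mult_mono abs_flux_le B_all, auto)
    show "F z = 0" if "z \<notin> K" for z using K(2)[OF that] by (simp add: F_def)
  qed
  \<comment> \<open>The speed is dominated by a product of a bounded function of \<open>x\<close> and \<open>1 / \<xi>(t)\<close>.\<close>
  have int1: "integrable lborel (\<lambda>z. ?I z * (speed (fst z $ i) (snd z) * \<phi> z))"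
  proof (rule Bochner_Integration.integrable_bound)
    have "compact (fst ` K)" using K(1) by (intro compact_continuous_image continuous_intros)
    then have "integrable lborel (\<lambda>x. indicator (fst ` K) x * B)"
      by (intro integrable_lborel_bounded_support[of _ "fst ` K" "\<bar>B\<bar>"])
         (auto intro!: borel_measurable_times borel_measurable_indicator borel_closed compact_imp_closed)
    from integrable_lborel_product[OF this integrable_inverse_xi[OF T]]
    show "integrable lborel (\<lambda>z. indicator (fst ` K) (fst z) * B * (indicator {0..T} (snd z) * (1 / xi (snd z))))" .
    show "AE z in lborel. norm (?I z * (speed (fst z $ i) (snd z) * \<phi> z))
        \<le> norm (indicator (fst ` K) (fst z) * B * (indicator {0..T} (snd z) * (1 / xi (snd z))))"
    proof (rule AE_I2)
      fix z :: spacetime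
      show "norm (?I z * (speed (fst z $ i) (snd z) * \<phi> z))
        \<le> norm (indicator (fst ` K) (fst z) * B * (indicator {0..T} (snd z) * (1 / xi (snd z))))"
      proof (cases "z \<in> K \<and> 0 < snd z \<and> snd z < T")
        case True
        then have "?I z = 1" "indicator (fst ` K) (fst z) = (1::real)" "indicator {0..T} (snd z) = (1::real)"
          by (auto simp: indicator_def mem_Times_iff)
        moreover have "\<bar>speed (fst z $ i) (snd z)\<bar> * \<bar>\<phi> z\<bar> \<le> (1 / xi (snd z)) * \<bar>B\<bar>"
          using B_all xi_nonneg by (intro mult_mono abs_speed_le) auto
        ultimately show ?thesis using xi_nonneg[of "snd z"] by (simp add: abs_mult mult.commute)
      next
        case False
        then have zero: "?I z * (speed (fst z $ i) (snd z) * \<phi> z) = 0"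
          using K(2)[of z] by (auto simp: indicator_def mem_Times_iff)
        show ?thesis unfolding zero by simp
      qed
    qed
  qed measurable
  have int2: "integrable lborel (\<lambda>z. ?I z * (flux (fst z $ i) (snd z) * ?D z))"
  proof (rule integrable_lborel_bounded_support[OF _ K(1)])
    show "\<bar>?I z * (flux (fst z $ i) (snd z) * ?D z)\<bar> \<le> 1 * \<bar>B'\<bar>" for z
      by (rule order_trans[OF I_le]) (unfold abs_mult, intro mult_mono abs_flux_le B_all, auto)
    show "?I z * (flux (fst z $ i) (snd z) * ?D z) = 0" if "z \<notin> K" for z using K(3)[OF that] by simp
  qed measurable
  show int_f: "integrable lborel f"
    unfolding f_def distrib_left using int1 int2 by (rule Bochner_Integration.integrable_add)
  show "integral\<^sup>L lborel f = 0"
  proof (rule integral_directional_derivative_eq_0[OF int_F int_f, of "e_space i"])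
    fix z :: spacetime
    let ?z = "\<lambda>r. z + r *\<^sub>R e_space i"
    have snd_z: "snd (?z r) = snd z" and fst_z: "fst (?z r) $ i = fst z $ i + r" for r
      by (rule spacetime_add_e_space)+
    have I_z: "?I (?z r) = (if 0 < snd z \<and> snd z < T then 1 else 0)" for r
      unfolding indicator_def mem_Times_iff snd_z by simp
    show "(LINT r:{0..1}|lborel. f (?z r)) = F (z + e_space i) - F z"
    proof (cases "0 < snd z \<and> snd z < T")
      case False
      then have I_0: "?I (?z r) = 0" for r unfolding I_z by auto
      have "f (?z r) = 0" "F (?z r) = 0" for r unfolding f_def F_def I_0 by simp_all
      from this(1) this(2)[of 0] this(2)[of 1] show ?thesis
        by (simp add: set_lebesgue_integral_def)
    next
      case True
      then have I_1: "?I (?z r) = 1" for r unfolding I_z by auto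
      have t: "snd z > 0" using True by simp
      have f: "f (?z r) = speed (fst z $ i + r) (snd z) * \<phi> (?z r)
          + flux (fst z $ i + r) (snd z) * ?D (?z r)"
        and F: "F (?z r) = flux (fst z $ i + r) (snd z) * \<phi> (?z r)" for r
        unfolding f_def F_def I_1 snd_z fst_z by simp_all
      have "(LINT r:{0..1}|lborel. f (?z r)) = F (?z 1) - F (?z 0)"
      proof (rule line_integral_piecewise_derivative[OF finite_front_crossings])
        show "continuous_on {0..1} (\<lambda>r. F (?z r))"
          unfolding F flux_def using xi_pos[OF t]
          by (intro continuous_intros continuous_on_compose2[OF cont(1)]) auto
        show "(\<lambda>r. f (?z r)) \<in> borel_measurable borel"
          using int_f by measurable
        show "\<bar>f (?z r)\<bar> \<le> 1 / xi (snd z) * \<bar>B\<bar> + 1 * \<bar>B'\<bar>" for r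
          unfolding f using xi_nonneg
          by (intro order_trans[OF abs_triangle_ineq] add_mono; unfold abs_mult,
              intro mult_mono abs_speed_le abs_flux_le B_all) auto
        fix r assume "r \<in> {0<..<1} - {r. \<bar>fst z $ i + r\<bar> = xi (snd z)}"
        then have "\<bar>fst z $ i + r\<bar> \<noteq> xi (snd z)" by simp
        then have "((\<lambda>r. flux (r + fst z $ i) (snd z)) has_real_derivative speed (fst z $ i + r) (snd z)) (at r)"
          using flux_has_derivative_space[OF t, of "fst z $ i + r"]
            DERIV_shift[of "\<lambda>y. flux y (snd z)" _ r "fst z $ i"] by (simp add: add.commute)
        moreover have "((\<lambda>r. \<phi> (?z r)) has_real_derivative ?D (?z r)) (at r)"
          using test_function_has_partial[OF \<phi>, of "e_space i" "?z r"] unfolding has_partial_shift .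
        ultimately show "((\<lambda>r. F (?z r)) has_real_derivative f (?z r)) (at r)"
          unfolding F f by (auto dest: DERIV_mult simp: algebra_simps)
      qed
      then show ?thesis by simp
    qed
  qed
qed

lemma sigma_field_measurable:
  "sigma_field \<in> borel_measurable (lebesgue_on (UNIV \<times> {0<..}))"
proof (rule continuous_imp_measurable_on_sets_lebesgue)
  show "continuous_on (UNIV \<times> {0<..}) sigma_field"
    unfolding sigma_field_def flux_def
    using xi_pos by (intro continuous_intros continuous_on_xi_snd continuous_on_vec_lambda) force
  show "UNIV \<times> {0<..} \<in> sets (lebesgue :: spacetime measure)"
    using open_upper by (auto intro: lebesgue_openin)
qed

lemma u_sol_weak_solution: "weak_solution_with sigma_field (u_sol R) (u_init R)"
  unfolding weak_solution_with_def
proof (intro conjI exI allI impI ballI)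
  show "u_sol R (x, 0) = u_init R x" for x
    using u_sol_eq[of R x 0] by (simp add: u_init_def sum_2 profile_def hh_def xi_def max_def del: u_sol.simps)
  show "AE z in lebesgue_on (UNIV \<times> {0<..}).
      \<forall>i. sigma_field z $ i \<in> multi_sgn (slope (fst z $ i) (snd z))"
  proof (rule AE_I2)
    fix z assume "z \<in> space (lebesgue_on (UNIV \<times> {0<..}) :: spacetime measure)"
    then have "snd z > 0" by (auto simp: space_restrict_space)
    then show "\<forall>i. sigma_field z $ i \<in> multi_sgn (slope (fst z $ i) (snd z))"
      by (simp add: sigma_field_def flux_in_multi_sgn)
  qed
  fix T :: real and \<phi> assume T: "T > 0" and \<phi>: "\<phi> \<in> test_functions (UNIV \<times> {..<T} :: spacetime set)"
  define g where "g z = (\<Sum>i\<in>UNIV. indicator (UNIV \<times> {0<..<T}) z * (speed (fst z $ i) (snd z) * \<phi> z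
      + flux (fst z $ i) (snd z) * frechet_derivative \<phi> (at z) (e_space i)))" for z
  have eq: "indicator (UNIV \<times> {0<..<T}) z *\<^sub>R ((\<Sum>i\<in>UNIV. speed (fst z $ i) (snd z)) * \<phi> z
      + (\<Sum>i\<in>UNIV. sigma_field z $ i * frechet_derivative \<phi> (at z) (e_space i))) = g z" for z
    by (simp add: g_def sigma_field_def sum_distrib_left sum_distrib_right sum.distrib distrib_left)
  have int: "integrable lborel g"
    unfolding g_def by (intro Bochner_Integration.integrable_sum flux_divergence_theorem T \<phi>)
  then have meas: "g \<in> borel_measurable lborel" by auto
  show "set_integrable lebesgue (UNIV \<times> {0<..<T}) (\<lambda>z. (\<Sum>i\<in>UNIV. speed (fst z $ i) (snd z)) * \<phi> z
      + (\<Sum>i\<in>UNIV. sigma_field z $ i * frechet_derivative \<phi> (at z) (e_space i)))"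
    unfolding set_integrable_def eq using int meas by (simp add: integrable_completion)
  have "integral\<^sup>L lborel g = 0"
    unfolding g_def using flux_divergence_theorem[OF T \<phi>]
    by (subst Bochner_Integration.integral_sum) simp_all
  then show "(LINT z:UNIV \<times> {0<..<T}|lebesgue. (\<Sum>i\<in>UNIV. speed (fst z $ i) (snd z)) * \<phi> z
      + (\<Sum>i\<in>UNIV. sigma_field z $ i * frechet_derivative \<phi> (at z) (e_space i))) = 0"
    unfolding set_lebesgue_integral_def eq using meas by (simp add: integral_completion)
qed (fact sigma_field_measurable u_sol_weak_time_derivative u_sol_weak_space_derivative)+

section \<open>Regularity\<close>

lemma abs_diff_squares_le:
  fixes a b :: real
  assumes "\<bar>a\<bar> \<le> M" "\<bar>b\<bar> \<le> M"
  shows "\<bar>a\<^sup>2 - b\<^sup>2\<bar> \<le> 2 * M * \<bar>a - b\<bar>"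
proof -
  have "\<bar>a\<^sup>2 - b\<^sup>2\<bar> = \<bar>a + b\<bar> * \<bar>a - b\<bar>"
    by (simp add: power2_eq_square algebra_simps flip: abs_mult)
  also have "\<dots> \<le> 2 * M * \<bar>a - b\<bar>" using assms by (intro mult_right_mono) auto
  finally show ?thesis .
qed

text \<open>The time dependence enters only through \<open>h\<close>. At equal times the second term drops out, which yields
  Lipschitz continuity in \<open>x\<close> down to \<open>t = 0\<close>.\<close>

lemma u_sol_diff_le:
  assumes "\<And>i. \<bar>x $ i\<bar> \<le> M" "\<And>i. \<bar>x' $ i\<bar> \<le> M"
  shows "\<bar>u_sol R (x, t) - u_sol R (x', t')\<bar> \<le> 4 * M * dist x x' + 2 * \<bar>hh t - hh t'\<bar>"
proof -
  have M: "0 \<le> M" using assms(1)[of 1] by linarith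
  have "\<bar>u_sol R (x, t) - u_sol R (x', t')\<bar> = \<bar>\<Sum>i\<in>UNIV. profile (x $ i) t - profile (x' $ i) t'\<bar>"
    by (simp add: u_sol_eq sum_subtractf del: u_sol.simps)
  also have "\<dots> \<le> (\<Sum>i\<in>(UNIV::2 set). 2 * M * dist x x' + \<bar>hh t - hh t'\<bar>)"
  proof (rule order_trans[OF sum_abs sum_mono])
    fix i
    have "2 * M * \<bar>x $ i - x' $ i\<bar> \<le> 2 * M * dist x x'"
      using dist_vec_nth_le[of x i x'] M by (intro mult_left_mono) (auto simp: dist_real_def)
    then show "\<bar>profile (x $ i) t - profile (x' $ i) t'\<bar> \<le> 2 * M * dist x x' + \<bar>hh t - hh t'\<bar>"
      using profile_diff[of "x $ i" t "x' $ i" t'] abs_diff_squares_le[OF assms(1)[of i] assms(2)[of i]] by linarith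
  qed
  also have "\<dots> = 4 * M * dist x x' + 2 * \<bar>hh t - hh t'\<bar>" by simp
  finally show ?thesis .
qed

text \<open>The bound degenerates only as \<open>t \<rightarrow> 0\<close>, where \<open>h' = 1 / \<xi>\<close> blows up; on a compact set of positive times
  \<open>\<xi>\<close> is bounded away from \<open>0\<close>.\<close>

lemma u_sol_lipschitz_on_compact:
  assumes K: "compact K" "K \<subseteq> UNIV \<times> {0<..}"
  shows "\<exists>L. L-lipschitz_on K (u_sol R)"
proof -
  obtain M where M: "\<And>z. z \<in> K \<Longrightarrow> norm z \<le> M" using compact_imp_bounded[OF K(1)] by (auto simp: bounded_iff)
  have "bounded ((\<lambda>z. 1 / xi (snd z)) ` K)"
    by (intro compact_imp_bounded compact_continuous_image continuous_on_subset[OF continuous_on_inverse_xi] K)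
  then obtain B0 where "\<forall>z\<in>K. \<bar>1 / xi (snd z)\<bar> \<le> B0" by (auto simp: bounded_iff)
  then have B0: "1 / xi (snd z) \<le> max B0 1" if "z \<in> K" for z
    using that by (auto simp: le_max_iff_disj intro: order_trans[OF abs_ge_self])
  \<comment> \<open>The maximum with \<open>1\<close> makes the bound positive even if \<open>K\<close> is empty.\<close>
  define B where "B = max B0 1"
  have B: "B > 0" by (simp add: B_def)
  have low: "1 / B \<le> xi (snd z)" if "z \<in> K" for z
  proof -
    have "xi (snd z) > 0" using that K(2) by (intro xi_pos) auto
    then show ?thesis using B0[OF that] B by (simp add: B_def[symmetric] field_simps)
  qed
  have "(4 * \<bar>M\<bar> + 3 * B)-lipschitz_on K (u_sol R)"
  proof (rule lipschitz_onI)
    fix z z' assume z: "z \<in> K" "z' \<in> K"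
    have coord: "\<bar>fst w $ i\<bar> \<le> \<bar>M\<bar>" if "w \<in> K" for w i
      using M[OF that] component_le_norm_cart[of "fst w" i] norm_fst_le[of "fst w" "snd w"] by simp
    have "0 \<le> snd z" "0 \<le> snd z'" using z K(2) by auto
    from hh_Lipschitz_estimate[OF this low[OF z(1)] low[OF z(2)]]
    have h: "2 * \<bar>hh (snd z) - hh (snd z')\<bar> \<le> 3 * B * \<bar>snd z - snd z'\<bar>"
      using B by (simp add: field_simps)
    have "\<bar>u_sol R (fst z, snd z) - u_sol R (fst z', snd z')\<bar>
        \<le> 4 * \<bar>M\<bar> * dist (fst z) (fst z') + 2 * \<bar>hh (snd z) - hh (snd z')\<bar>"
      by (intro u_sol_diff_le coord z)
    also have "\<dots> \<le> 4 * \<bar>M\<bar> * dist z z' + 3 * B * dist z z'"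
      using h B dist_fst_le[of z z'] dist_snd_le[of z z']
      by (intro add_mono mult_left_mono order_trans[OF h]) (auto simp: dist_real_def)
    finally show "dist (u_sol R z) (u_sol R z') \<le> (4 * \<bar>M\<bar> + 3 * B) * dist z z'"
      by (simp add: dist_real_def distrib_right del: u_sol.simps)
  qed (use B in auto)
  then show ?thesis by blast
qed

lemma u_sol_local_lipschitz: "local_lipschitz {0..} UNIV (\<lambda>t x. u_sol R (x, t))"
  unfolding local_lipschitz_def
proof (intro ballI)
  fix x :: "real^2" and t :: real
  let ?L = "4 * (norm x + 1)"
  have coord: "\<bar>y $ i\<bar> \<le> norm x + 1" if "y \<in> cball x 1" for y i
    using that component_le_norm_cart[of y i] norm_triangle_ineq2[of y x]
    by (simp add: dist_norm norm_minus_commute)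
  have "?L-lipschitz_on (cball x 1 \<inter> UNIV) (\<lambda>x. u_sol R (x, s))" for s
  proof (rule lipschitz_onI)
    fix y y' assume "y \<in> cball x 1 \<inter> UNIV" "y' \<in> cball x 1 \<inter> UNIV"
    then have "\<bar>u_sol R (y, s) - u_sol R (y', s)\<bar> \<le> ?L * dist y y' + 2 * \<bar>hh s - hh s\<bar>"
      by (intro u_sol_diff_le coord) auto
    then show "dist (u_sol R (y, s)) (u_sol R (y', s)) \<le> ?L * dist y y'"
      by (simp add: dist_real_def del: u_sol.simps)
  qed simp
  then show "\<exists>u>0. \<exists>L. \<forall>t\<in>cball t u \<inter> {0..}. L-lipschitz_on (cball x u \<inter> UNIV) (\<lambda>x. u_sol R (x, t))"
    using zero_less_one by blast
qed

lemma u_sol_not_C1: "\<not> Ck_on 1 (UNIV \<times> {0<..}) (u_sol R)"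
proof
  assume "Ck_on 1 (UNIV \<times> {0<..}) (u_sol R)"
  moreover define z :: spacetime where "z = ((\<chi> i. xi 1), 1)"
  ultimately have "u_sol R differentiable (at z)" by auto
  then have "has_partial (u_sol R) (e_space 1) (frechet_derivative (u_sol R) (at z) (e_space 1)) z"
    by (intro has_partial_frechet_derivative)
  then show False
    unfolding z_def has_partial_u_sol_space_iff
    using profile_not_differentiable_at_front[of 1 "xi 1"] xi_nonneg[of 1] by simp
qed

theorem proposition2p1:
  fixes R :: real
  assumes "R > 0"
  shows "(\<exists>\<sigma>. weak_solution_with \<sigma> (u_sol R) (u_init R) \<and>
              (\<forall>t>0. hausdorff_dim {x. \<not> satisfied_pointwise \<sigma> (u_sol R) (x, t)} = 1)) \<and>
         (\<forall>K. compact K \<and> K \<subseteq> UNIV \<times> {0<..} \<longrightarrow> (\<exists>L. L-lipschitz_on K (u_sol R))) \<and>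
         local_lipschitz {0..} UNIV (\<lambda>t x. u_sol R (x, t)) \<and>
         continuous_on (UNIV \<times> {0..}) (u_sol R) \<and>
         \<not> Ck_on 1 (UNIV \<times> {0<..}) (u_sol R)"
proof (intro conjI)
  have "hausdorff_dim {x. \<not> satisfied_pointwise sigma_field (u_sol R) (x, t)} = 1" if "t > 0" for t
    using hausdorff_dim_front[OF xi_nonneg] by (simp add: satisfied_pointwise_iff[OF that])
  then show "\<exists>\<sigma>. weak_solution_with \<sigma> (u_sol R) (u_init R) \<and>
      (\<forall>t>0. hausdorff_dim {x. \<not> satisfied_pointwise \<sigma> (u_sol R) (x, t)} = 1)"
    using u_sol_weak_solution by blast
  show "\<forall>K. compact K \<and> K \<subseteq> UNIV \<times> {0<..} \<longrightarrow> (\<exists>L. L-lipschitz_on K (u_sol R))"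
    using u_sol_lipschitz_on_compact by blast
qed (fact u_sol_local_lipschitz continuous_on_u_sol u_sol_not_C1)+

end
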